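(* Let $(\Pi,A,\xi)$ and $(\Pi',A',\xi')$ be Gr-categories of type $(\Pi,A)$ and $(\Pi',A')$ respectively. 1) Let $\varphi:\Pi\to\Pi'$ and $f:A\to A'$ be group homomorphisms with $f(xa)=\varphi(x)f(a)$ for all $x\in\Pi,a\in A$, and suppose that the obstruction of the functor of the type $(\varphi,f)$ vanishes, i.e. the class of $\varphi^*\xi'-f_*\xi$ is $0$ in $H^3(\Pi,A')$, where $A'$ is a $\Pi$-module with the action $xa'=\varphi(x)a'$. Then there exists a bijection between the set of congruence classes of Gr-functors of the type $(\varphi,f)$ from $(\Pi,A,\xi)$ to $(\Pi',A',\xi')$ and the cohomology group $H^2(\Pi,A')$. 2) If $F:(\Pi,A,\xi)\to(\Pi',A',\xi')$ is a Gr-functor, of the type $(\varphi,f)$, then there exists a bijection $$\mathrm{Aut}(F)\to Z^1(\Pi,A'),$$ where $Z^1(\Pi,A')$ is the group of 1-cocycles of $\Pi$ with coefficients in $A'$, with the $\Pi$-action $xa'=\varphi(x)a'$.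
   Context: A Gr-category is a monoidal category $(\mathcal C,\otimes,I,a,l,r)$ in which every object is invertible (for $\otimes$, up to isomorphism) and every arrow is an isomorphism; the associativity constraint is directed as $a_{X,Y,Z}:X\otimes(Y\otimes Z)\to(X\otimes Y)\otimes Z$. A Gr-functor is a monoidal functor $(F,\widetilde F,\hat F)$ between Gr-categories, with natural isomorphisms $\widetilde F_{X,Y}:FX\otimes FY\to F(X\otimes Y)$ and an isomorphism $\hat F:I'\to FI$ satisfying the usual coherence conditions. A natural monoidal transformation $\alpha:(F,\widetilde F,\hat F)\to(G,\widetilde G,\hat G)$ is a natural transformation with $\widetilde G_{X,Y}\circ(\alpha_X\otimes\alpha_Y)=\alpha_{X\otimes Y}\circ\widetilde F_{X,Y}$ and $\alpha_I\circ\hat F=\hat G$. Two Gr-functors are congruent if there is a natural monoidal isomorphism between them. $\mathrm{Aut}(F)$ is the set of natural monoidal automorphisms of $(F,\widetilde F,\hat F)$. Given a group $\Pi$, a (left) $\Pi$-module $A$ (written additively) and a normalized 3-cocycle $\xi:\Pi^3\to A$, the Gr-category $(\Pi,A,\xi)$ (of type $(\Pi,A)$) has as objects the elements of $\Pi$ and as arrows the automorphisms $(x,u):x\to x$ with $x\in\Pi$, $u\in A$ (no arrows between distinct objects); composition is $(x,u).(x,v)=(x,u+v)$; the tensor product is $x\otimes y=xy$, $(x,u)\otimes(y,v)=(xy,u+xv)$; the unit constraints are identities (with unit object $1$); and the associativity constraint is $a_{x,y,z}=(xyz,\xi(x,y,z))$. A functor $F:(\Pi,A,\xi)\to(\Pi',A',\xi')$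 is of the type $(\varphi,f)$ if $F(x)=\varphi(x)$ and $F(x,u)=(\varphi(x),f(u))$, where $\varphi:\Pi\to\Pi'$ and $f:A\to A'$ are group homomorphisms with $f(xa)=\varphi(x)f(a)$. A Gr-functor of the type $(\varphi,f)$ is a Gr-functor whose underlying functor is of the type $(\varphi,f)$. Every Gr-functor between such Gr-categories is of the type $(\varphi,f)$ for some such pair. Here $(f_*\xi)(x,y,z)=f(\xi(x,y,z))$ and $(\varphi^*\xi')(x,y,z)=\xi'(\varphi x,\varphi y,\varphi z)$. *)

theory Defs
  imports "HOL-Algebra.Module" "HOL-Algebra.Coset" "HOL-Algebra.Product_Groups"
begin

section \<open>Monoidal categories and Gr-categories\<close>

record ('o, 'm) category =
  Obj  :: "'o set"
  Arr  :: "'m set"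
  Dom  :: "'m \<Rightarrow> 'o"
  Cod  :: "'m \<Rightarrow> 'o"
  Id   :: "'o \<Rightarrow> 'm"
  Comp :: "'m \<Rightarrow> 'm \<Rightarrow> 'm"  (infixr \<open>\<cdot>\<index>\<close> 55)

definition Hom :: "('o, 'm, 'z) category_scheme \<Rightarrow> 'o \<Rightarrow> 'o \<Rightarrow> 'm set"
  where "Hom C X Y = {h \<in> Arr C. Dom C h = X \<and> Cod C h = Y}"

text \<open>Composition is only constrained on composable pairs, and is written in
  applicative order: \<open>g \<cdot> h\<close> is \<open>h\<close> followed by \<open>g\<close>.\<close>

locale category =
  fixes C :: "('o, 'm, 'z) category_scheme" (structure)
  assumes Dom_closed: "h \<in> Arr C \<Longrightarrow> Dom C h \<in> Obj C"
    and Cod_closed: "h \<in> Arr C \<Longrightarrow> Cod C h \<in> Obj C"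
    and Id_closed: "X \<in> Obj C \<Longrightarrow> Id C X \<in> Hom C X X"
    and Comp_closed: "\<lbrakk>h \<in> Hom C X Y; g \<in> Hom C Y Z\<rbrakk> \<Longrightarrow> g \<cdot> h \<in> Hom C X Z"
    and Id_left: "h \<in> Hom C X Y \<Longrightarrow> Id C Y \<cdot> h = h"
    and Id_right: "h \<in> Hom C X Y \<Longrightarrow> h \<cdot> Id C X = h"
    and Comp_assoc: "\<lbrakk>h \<in> Hom C X Y; g \<in> Hom C Y Z; k \<in> Hom C Z W\<rbrakk>
      \<Longrightarrow> (k \<cdot> g) \<cdot> h = k \<cdot> (g \<cdot> h)"

definition is_iso_arr :: "('o, 'm, 'z) category_scheme \<Rightarrow> 'm \<Rightarrow> bool"
  where "is_iso_arr C h \<longleftrightarrow> h \<in> Arr C \<and>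
    (\<exists>g \<in> Hom C (Cod C h) (Dom C h).
       g \<cdot>\<^bsub>C\<^esub> h = Id C (Dom C h) \<and> h \<cdot>\<^bsub>C\<^esub> g = Id C (Cod C h))"

definition isomorphic_objs :: "('o, 'm, 'z) category_scheme \<Rightarrow> 'o \<Rightarrow> 'o \<Rightarrow> bool"
  where "isomorphic_objs C X Y \<longleftrightarrow> (\<exists>h \<in> Hom C X Y. is_iso_arr C h)"

record ('o, 'm) monoidal_cat = "('o, 'm) category" +
  TensorO :: "'o \<Rightarrow> 'o \<Rightarrow> 'o"  (infixl \<open>\<boxdot>\<index>\<close> 70)
  TensorA :: "'m \<Rightarrow> 'm \<Rightarrow> 'm"  (infixl \<open>\<boxtimes>\<index>\<close> 70)
  Unit    :: "'o"
  Assoc   :: "'o \<Rightarrow> 'o \<Rightarrow> 'o \<Rightarrow> 'm"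
  LUnit   :: "'o \<Rightarrow> 'm"
  RUnit   :: "'o \<Rightarrow> 'm"

locale monoidal_category = category C
  for C :: "('o, 'm, 'z) monoidal_cat_scheme" (structure) +
  assumes TensorO_closed: "\<lbrakk>X \<in> Obj C; Y \<in> Obj C\<rbrakk> \<Longrightarrow> X \<boxdot> Y \<in> Obj C"
    and TensorA_closed: "\<lbrakk>h \<in> Hom C X X'; k \<in> Hom C Y Y'\<rbrakk> \<Longrightarrow> h \<boxtimes> k \<in> Hom C (X \<boxdot> Y) (X' \<boxdot> Y')"
    and TensorA_Id: "\<lbrakk>X \<in> Obj C; Y \<in> Obj C\<rbrakk> \<Longrightarrow> Id C X \<boxtimes> Id C Y = Id C (X \<boxdot> Y)"
    and TensorA_Comp: "\<lbrakk>h \<in> Hom C X X'; h' \<in> Hom C X' X''; k \<in> Hom C Y Y'; k' \<in> Hom C Y' Y''\<rbrakk>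
      \<Longrightarrow> (h' \<cdot> h) \<boxtimes> (k' \<cdot> k) = (h' \<boxtimes> k') \<cdot> (h \<boxtimes> k)"
    and Unit_closed: "Unit C \<in> Obj C"
    and Assoc_closed: "\<lbrakk>X \<in> Obj C; Y \<in> Obj C; Z \<in> Obj C\<rbrakk>
      \<Longrightarrow> Assoc C X Y Z \<in> Hom C (X \<boxdot> (Y \<boxdot> Z)) ((X \<boxdot> Y) \<boxdot> Z)"
    and Assoc_iso: "\<lbrakk>X \<in> Obj C; Y \<in> Obj C; Z \<in> Obj C\<rbrakk> \<Longrightarrow> is_iso_arr C (Assoc C X Y Z)"
    and Assoc_natural: "\<lbrakk>h \<in> Hom C X X'; k \<in> Hom C Y Y'; l \<in> Hom C Z Z'\<rbrakk>
      \<Longrightarrow> Assoc C X' Y' Z' \<cdot> (h \<boxtimes> (k \<boxtimes> l)) = ((h \<boxtimes> k) \<boxtimes> l) \<cdot> Assoc C X Y Z"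
    and LUnit_closed: "X \<in> Obj C \<Longrightarrow> LUnit C X \<in> Hom C (Unit C \<boxdot> X) X"
    and LUnit_iso: "X \<in> Obj C \<Longrightarrow> is_iso_arr C (LUnit C X)"
    and LUnit_natural: "h \<in> Hom C X X' \<Longrightarrow> LUnit C X' \<cdot> (Id C (Unit C) \<boxtimes> h) = h \<cdot> LUnit C X"
    and RUnit_closed: "X \<in> Obj C \<Longrightarrow> RUnit C X \<in> Hom C (X \<boxdot> Unit C) X"
    and RUnit_iso: "X \<in> Obj C \<Longrightarrow> is_iso_arr C (RUnit C X)"
    and RUnit_natural: "h \<in> Hom C X X' \<Longrightarrow> RUnit C X' \<cdot> (h \<boxtimes> Id C (Unit C)) = h \<cdot> RUnit C X"
    and pentagon: "\<lbrakk>X \<in> Obj C; Y \<in> Obj C; Z \<in> Obj C; T \<in> Obj C\<rbrakk>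
      \<Longrightarrow> Assoc C (X \<boxdot> Y) Z T \<cdot> Assoc C X Y (Z \<boxdot> T)
        = (Assoc C X Y Z \<boxtimes> Id C T) \<cdot> (Assoc C X (Y \<boxdot> Z) T \<cdot> (Id C X \<boxtimes> Assoc C Y Z T))"
    and triangle: "\<lbrakk>X \<in> Obj C; Y \<in> Obj C\<rbrakk>
      \<Longrightarrow> (RUnit C X \<boxtimes> Id C Y) \<cdot> Assoc C X (Unit C) Y = Id C X \<boxtimes> LUnit C Y"

locale gr_category = monoidal_category C
  for C :: "('o, 'm, 'z) monoidal_cat_scheme" (structure) +
  assumes all_arr_iso: "h \<in> Arr C \<Longrightarrow> is_iso_arr C h"
    and all_obj_invertible: "X \<in> Obj C \<Longrightarrow>
      \<exists>Y \<in> Obj C. isomorphic_objs C (X \<boxdot> Y) (Unit C) \<and> isomorphic_objs C (Y \<boxdot> X) (Unit C)"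


section \<open>Gr-functors and natural monoidal transformations\<close>

record ('o, 'm, 'p, 'n) mon_functor =
  FObj    :: "'o \<Rightarrow> 'p"
  FArr    :: "'m \<Rightarrow> 'n"
  FTensor :: "'o \<times> 'o \<Rightarrow> 'n"
  FUnit   :: "'n"

text \<open>All component maps are extensional (undefined outside the objects and arrows of the
  source), so that elements of the type satisfying the predicates below correspond one to one
  to the mathematical objects.\<close>

locale gr_functor = C: gr_category C + D: gr_category D
  for C :: "('o, 'm, 'z) monoidal_cat_scheme"
    and D :: "('p, 'n, 'y) monoidal_cat_scheme"
    and F :: "('o, 'm, 'p, 'n) mon_functor" +
  assumes FObj_closed: "FObj F \<in> Obj C \<rightarrow>\<^sub>E Obj D"
    and FArr_closed: "FArr F \<in> Arr C \<rightarrow>\<^sub>E Arr D"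
    and FArr_Hom: "h \<in> Hom C X Y \<Longrightarrow> FArr F h \<in> Hom D (FObj F X) (FObj F Y)"
    and FArr_Id: "X \<in> Obj C \<Longrightarrow> FArr F (Id C X) = Id D (FObj F X)"
    and FArr_Comp: "\<lbrakk>h \<in> Hom C X Y; g \<in> Hom C Y Z\<rbrakk>
      \<Longrightarrow> FArr F (g \<cdot>\<^bsub>C\<^esub> h) = FArr F g \<cdot>\<^bsub>D\<^esub> FArr F h"
    and FTensor_closed: "FTensor F \<in> Obj C \<times> Obj C \<rightarrow>\<^sub>E Arr D"
    and FTensor_Hom: "\<lbrakk>X \<in> Obj C; Y \<in> Obj C\<rbrakk>
      \<Longrightarrow> FTensor F (X, Y) \<in> Hom D (FObj F X \<boxdot>\<^bsub>D\<^esub> FObj F Y) (FObj F (X \<boxdot>\<^bsub>C\<^esub> Y))"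
    and FTensor_iso: "\<lbrakk>X \<in> Obj C; Y \<in> Obj C\<rbrakk> \<Longrightarrow> is_iso_arr D (FTensor F (X, Y))"
    and FTensor_natural: "\<lbrakk>h \<in> Hom C X X'; k \<in> Hom C Y Y'\<rbrakk>
      \<Longrightarrow> FTensor F (X', Y') \<cdot>\<^bsub>D\<^esub> (FArr F h \<boxtimes>\<^bsub>D\<^esub> FArr F k)
        = FArr F (h \<boxtimes>\<^bsub>C\<^esub> k) \<cdot>\<^bsub>D\<^esub> FTensor F (X, Y)"
    and FUnit_Hom: "FUnit F \<in> Hom D (Unit D) (FObj F (Unit C))"
    and FUnit_iso: "is_iso_arr D (FUnit F)"
    and F_assoc: "\<lbrakk>X \<in> Obj C; Y \<in> Obj C; Z \<in> Obj C\<rbrakk>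
      \<Longrightarrow> FArr F (Assoc C X Y Z) \<cdot>\<^bsub>D\<^esub>
            (FTensor F (X, Y \<boxdot>\<^bsub>C\<^esub> Z) \<cdot>\<^bsub>D\<^esub> (Id D (FObj F X) \<boxtimes>\<^bsub>D\<^esub> FTensor F (Y, Z)))
        = FTensor F (X \<boxdot>\<^bsub>C\<^esub> Y, Z) \<cdot>\<^bsub>D\<^esub>
            ((FTensor F (X, Y) \<boxtimes>\<^bsub>D\<^esub> Id D (FObj F Z)) \<cdot>\<^bsub>D\<^esub>
              Assoc D (FObj F X) (FObj F Y) (FObj F Z))"
    and F_left_unit: "X \<in> Obj C
      \<Longrightarrow> FArr F (LUnit C X) \<cdot>\<^bsub>D\<^esub> (FTensor F (Unit C, X) \<cdot>\<^bsub>D\<^esub> (FUnit F \<boxtimes>\<^bsub>D\<^esub> Id D (FObj F X)))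
        = LUnit D (FObj F X)"
    and F_right_unit: "X \<in> Obj C
      \<Longrightarrow> FArr F (RUnit C X) \<cdot>\<^bsub>D\<^esub> (FTensor F (X, Unit C) \<cdot>\<^bsub>D\<^esub> (Id D (FObj F X) \<boxtimes>\<^bsub>D\<^esub> FUnit F))
        = RUnit D (FObj F X)"

locale monoidal_transformation = F: gr_functor C D F + G: gr_functor C D G
  for C :: "('o, 'm, 'z) monoidal_cat_scheme"
    and D :: "('p, 'n, 'y) monoidal_cat_scheme"
    and F G :: "('o, 'm, 'p, 'n) mon_functor"
    and \<alpha> :: "'o \<Rightarrow> 'n" +
  assumes components: "\<alpha> \<in> (\<Pi>\<^sub>E X \<in> Obj C. Hom D (FObj F X) (FObj G X))"
    and natural: "h \<in> Hom C X Y \<Longrightarrow> \<alpha> Y \<cdot>\<^bsub>D\<^esub> FArr F h = FArr G h \<cdot>\<^bsub>D\<^esub> \<alpha> X"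
    and tensor: "\<lbrakk>X \<in> Obj C; Y \<in> Obj C\<rbrakk>
      \<Longrightarrow> FTensor G (X, Y) \<cdot>\<^bsub>D\<^esub> (\<alpha> X \<boxtimes>\<^bsub>D\<^esub> \<alpha> Y) = \<alpha> (X \<boxdot>\<^bsub>C\<^esub> Y) \<cdot>\<^bsub>D\<^esub> FTensor F (X, Y)"
    and unit: "\<alpha> (Unit C) \<cdot>\<^bsub>D\<^esub> FUnit F = FUnit G"

definition monoidal_isos ::
    "('o, 'm, 'z) monoidal_cat_scheme \<Rightarrow> ('p, 'n, 'y) monoidal_cat_scheme
      \<Rightarrow> ('o, 'm, 'p, 'n) mon_functor \<Rightarrow> ('o, 'm, 'p, 'n) mon_functor \<Rightarrow> ('o \<Rightarrow> 'n) set"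
  where "monoidal_isos C D F G =
    {\<alpha>. monoidal_transformation C D F G \<alpha> \<and> (\<forall>X \<in> Obj C. is_iso_arr D (\<alpha> X))}"

definition congruent_functors ::
    "('o, 'm, 'z) monoidal_cat_scheme \<Rightarrow> ('p, 'n, 'y) monoidal_cat_scheme
      \<Rightarrow> ('o, 'm, 'p, 'n) mon_functor \<Rightarrow> ('o, 'm, 'p, 'n) mon_functor \<Rightarrow> bool"
  where "congruent_functors C D F G \<longleftrightarrow> monoidal_isos C D F G \<noteq> {}"

definition Aut ::
    "('o, 'm, 'z) monoidal_cat_scheme \<Rightarrow> ('p, 'n, 'y) monoidal_cat_scheme
      \<Rightarrow> ('o, 'm, 'p, 'n) mon_functor \<Rightarrow> ('o \<Rightarrow> 'n) set"
  where "Aut C D F = monoidal_isos C D F F"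


section \<open>Modules over a group and low-degree group cohomology\<close>

text \<open>The library record for modules serves as carrier of the data: the abelian group is its
  additive part and \<open>\<odot>\<close> is the action of the group. The ring multiplication of the record plays no
  role.\<close>

locale group_module = group \<Gamma> + M: abelian_group M
  for \<Gamma> :: "('g, 'z) monoid_scheme" and M :: "('g, 'a, 'y) module_scheme" +
  assumes act_closed: "\<lbrakk>x \<in> carrier \<Gamma>; a \<in> carrier M\<rbrakk> \<Longrightarrow> x \<odot>\<^bsub>M\<^esub> a \<in> carrier M"
    and act_add: "\<lbrakk>x \<in> carrier \<Gamma>; a \<in> carrier M; b \<in> carrier M\<rbrakk>
      \<Longrightarrow> x \<odot>\<^bsub>M\<^esub> (a \<oplus>\<^bsub>M\<^esub> b) = x \<odot>\<^bsub>M\<^esub> a \<oplus>\<^bsub>M\<^esub> x \<odot>\<^bsub>M\<^esub> b"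
    and act_mult: "\<lbrakk>x \<in> carrier \<Gamma>; y \<in> carrier \<Gamma>; a \<in> carrier M\<rbrakk>
      \<Longrightarrow> (x \<otimes>\<^bsub>\<Gamma>\<^esub> y) \<odot>\<^bsub>M\<^esub> a = x \<odot>\<^bsub>M\<^esub> (y \<odot>\<^bsub>M\<^esub> a)"
    and act_one: "a \<in> carrier M \<Longrightarrow> \<one>\<^bsub>\<Gamma>\<^esub> \<odot>\<^bsub>M\<^esub> a = a"

definition pullback_module :: "('g \<Rightarrow> 'h) \<Rightarrow> ('h, 'a, 'y) module_scheme \<Rightarrow> ('g, 'a) module"
  where "pullback_module \<phi> M =
    \<lparr>carrier = carrier M, monoid.mult = monoid.mult M, one = one M, zero = zero M, add = add M,
     smult = (\<lambda>x a. \<phi> x \<odot>\<^bsub>M\<^esub> a)\<rparr>"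

text \<open>Inhomogeneous, not necessarily normalized, cochains.\<close>

definition cochains1 :: "('g, 'z) monoid_scheme \<Rightarrow> ('g, 'a, 'y) module_scheme \<Rightarrow> ('g \<Rightarrow> 'a) monoid"
  where "cochains1 \<Gamma> M = product_group (carrier \<Gamma>) (\<lambda>_. add_monoid M)"

definition cochains2 ::
    "('g, 'z) monoid_scheme \<Rightarrow> ('g, 'a, 'y) module_scheme \<Rightarrow> ('g \<times> 'g \<Rightarrow> 'a) monoid"
  where "cochains2 \<Gamma> M = product_group (carrier \<Gamma> \<times> carrier \<Gamma>) (\<lambda>_. add_monoid M)"

definition cochains3 ::
    "('g, 'z) monoid_scheme \<Rightarrow> ('g, 'a, 'y) module_scheme \<Rightarrow> ('g \<times> 'g \<times> 'g \<Rightarrow> 'a) monoid"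
  where "cochains3 \<Gamma> M =
    product_group (carrier \<Gamma> \<times> carrier \<Gamma> \<times> carrier \<Gamma>) (\<lambda>_. add_monoid M)"

definition cochains4 ::
    "('g, 'z) monoid_scheme \<Rightarrow> ('g, 'a, 'y) module_scheme \<Rightarrow> ('g \<times> 'g \<times> 'g \<times> 'g \<Rightarrow> 'a) monoid"
  where "cochains4 \<Gamma> M =
    product_group (carrier \<Gamma> \<times> carrier \<Gamma> \<times> carrier \<Gamma> \<times> carrier \<Gamma>) (\<lambda>_. add_monoid M)"

definition coboundary1 ::
    "('g, 'z) monoid_scheme \<Rightarrow> ('g, 'a, 'y) module_scheme \<Rightarrow> ('g \<Rightarrow> 'a) \<Rightarrow> ('g \<times> 'g \<Rightarrow> 'a)"
  where "coboundary1 \<Gamma> M c = (\<lambda>(x, y) \<in> carrier \<Gamma> \<times> carrier \<Gamma>.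
    x \<odot>\<^bsub>M\<^esub> c y \<ominus>\<^bsub>M\<^esub> c (x \<otimes>\<^bsub>\<Gamma>\<^esub> y) \<oplus>\<^bsub>M\<^esub> c x)"

definition coboundary2 ::
    "('g, 'z) monoid_scheme \<Rightarrow> ('g, 'a, 'y) module_scheme
      \<Rightarrow> ('g \<times> 'g \<Rightarrow> 'a) \<Rightarrow> ('g \<times> 'g \<times> 'g \<Rightarrow> 'a)"
  where "coboundary2 \<Gamma> M c = (\<lambda>(x, y, z) \<in> carrier \<Gamma> \<times> carrier \<Gamma> \<times> carrier \<Gamma>.
    x \<odot>\<^bsub>M\<^esub> c (y, z) \<ominus>\<^bsub>M\<^esub> c (x \<otimes>\<^bsub>\<Gamma>\<^esub> y, z) \<oplus>\<^bsub>M\<^esub> c (x, y \<otimes>\<^bsub>\<Gamma>\<^esub> z) \<ominus>\<^bsub>M\<^esub> c (x, y))"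

definition coboundary3 ::
    "('g, 'z) monoid_scheme \<Rightarrow> ('g, 'a, 'y) module_scheme
      \<Rightarrow> ('g \<times> 'g \<times> 'g \<Rightarrow> 'a) \<Rightarrow> ('g \<times> 'g \<times> 'g \<times> 'g \<Rightarrow> 'a)"
  where "coboundary3 \<Gamma> M c =
    (\<lambda>(x, y, z, t) \<in> carrier \<Gamma> \<times> carrier \<Gamma> \<times> carrier \<Gamma> \<times> carrier \<Gamma>.
      x \<odot>\<^bsub>M\<^esub> c (y, z, t) \<ominus>\<^bsub>M\<^esub> c (x \<otimes>\<^bsub>\<Gamma>\<^esub> y, z, t) \<oplus>\<^bsub>M\<^esub> c (x, y \<otimes>\<^bsub>\<Gamma>\<^esub> z, t)
        \<ominus>\<^bsub>M\<^esub> c (x, y, z \<otimes>\<^bsub>\<Gamma>\<^esub> t) \<oplus>\<^bsub>M\<^esub> c (x, y, z))"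

definition Z1 :: "('g, 'z) monoid_scheme \<Rightarrow> ('g, 'a, 'y) module_scheme \<Rightarrow> ('g \<Rightarrow> 'a) monoid"
  where "Z1 \<Gamma> M = (cochains1 \<Gamma> M)
    \<lparr>carrier := kernel (cochains1 \<Gamma> M) (cochains2 \<Gamma> M) (coboundary1 \<Gamma> M)\<rparr>"

definition Z2 :: "('g, 'z) monoid_scheme \<Rightarrow> ('g, 'a, 'y) module_scheme \<Rightarrow> ('g \<times> 'g \<Rightarrow> 'a) monoid"
  where "Z2 \<Gamma> M = (cochains2 \<Gamma> M)
    \<lparr>carrier := kernel (cochains2 \<Gamma> M) (cochains3 \<Gamma> M) (coboundary2 \<Gamma> M)\<rparr>"

definition Z3 ::
    "('g, 'z) monoid_scheme \<Rightarrow> ('g, 'a, 'y) module_scheme \<Rightarrow> ('g \<times> 'g \<times> 'g \<Rightarrow> 'a) monoid"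
  where "Z3 \<Gamma> M = (cochains3 \<Gamma> M)
    \<lparr>carrier := kernel (cochains3 \<Gamma> M) (cochains4 \<Gamma> M) (coboundary3 \<Gamma> M)\<rparr>"

definition B2 :: "('g, 'z) monoid_scheme \<Rightarrow> ('g, 'a, 'y) module_scheme \<Rightarrow> ('g \<times> 'g \<Rightarrow> 'a) set"
  where "B2 \<Gamma> M = coboundary1 \<Gamma> M ` carrier (cochains1 \<Gamma> M)"

definition B3 :: "('g, 'z) monoid_scheme \<Rightarrow> ('g, 'a, 'y) module_scheme \<Rightarrow> ('g \<times> 'g \<times> 'g \<Rightarrow> 'a) set"
  where "B3 \<Gamma> M = coboundary2 \<Gamma> M ` carrier (cochains2 \<Gamma> M)"

definition H2 :: "('g, 'z) monoid_scheme \<Rightarrow> ('g, 'a, 'y) module_scheme \<Rightarrow> ('g \<times> 'g \<Rightarrow> 'a) set monoid"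
  where "H2 \<Gamma> M = Z2 \<Gamma> M Mod B2 \<Gamma> M"

definition H3 ::
    "('g, 'z) monoid_scheme \<Rightarrow> ('g, 'a, 'y) module_scheme \<Rightarrow> ('g \<times> 'g \<times> 'g \<Rightarrow> 'a) set monoid"
  where "H3 \<Gamma> M = Z3 \<Gamma> M Mod B3 \<Gamma> M"

definition class3 ::
    "('g, 'z) monoid_scheme \<Rightarrow> ('g, 'a, 'y) module_scheme
      \<Rightarrow> ('g \<times> 'g \<times> 'g \<Rightarrow> 'a) \<Rightarrow> ('g \<times> 'g \<times> 'g \<Rightarrow> 'a) set"
  where "class3 \<Gamma> M c = B3 \<Gamma> M #>\<^bsub>Z3 \<Gamma> M\<^esub> c"

definition normalized_3_cocycle ::
    "('g, 'z) monoid_scheme \<Rightarrow> ('g, 'a, 'y) module_scheme \<Rightarrow> ('g \<times> 'g \<times> 'g \<Rightarrow> 'a) \<Rightarrow> bool"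
  where "normalized_3_cocycle \<Gamma> M \<xi> \<longleftrightarrow> \<xi> \<in> carrier (Z3 \<Gamma> M) \<and>
    (\<forall>x \<in> carrier \<Gamma>. \<forall>y \<in> carrier \<Gamma>.
       \<xi> (\<one>\<^bsub>\<Gamma>\<^esub>, x, y) = \<zero>\<^bsub>M\<^esub> \<and> \<xi> (x, \<one>\<^bsub>\<Gamma>\<^esub>, y) = \<zero>\<^bsub>M\<^esub> \<and> \<xi> (x, y, \<one>\<^bsub>\<Gamma>\<^esub>) = \<zero>\<^bsub>M\<^esub>)"


section \<open>The Gr-category of a normalized 3-cocycle, and Gr-functors of a given type\<close>

definition gr_cat ::
    "('g, 'z) monoid_scheme \<Rightarrow> ('g, 'a, 'y) module_scheme \<Rightarrow> ('g \<times> 'g \<times> 'g \<Rightarrow> 'a)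
      \<Rightarrow> ('g, 'g \<times> 'a) monoidal_cat"
  where "gr_cat \<Gamma> A \<xi> =
    \<lparr>Obj = carrier \<Gamma>, Arr = carrier \<Gamma> \<times> carrier A, Dom = fst, Cod = fst,
     Id = (\<lambda>x. (x, \<zero>\<^bsub>A\<^esub>)),
     Comp = (\<lambda>(x, u) (_, v). (x, u \<oplus>\<^bsub>A\<^esub> v)),
     TensorO = (\<lambda>x y. x \<otimes>\<^bsub>\<Gamma>\<^esub> y),
     TensorA = (\<lambda>(x, u) (y, v). (x \<otimes>\<^bsub>\<Gamma>\<^esub> y, u \<oplus>\<^bsub>A\<^esub> x \<odot>\<^bsub>A\<^esub> v)),
     Unit = \<one>\<^bsub>\<Gamma>\<^esub>,
     Assoc = (\<lambda>x y z. (x \<otimes>\<^bsub>\<Gamma>\<^esub> y \<otimes>\<^bsub>\<Gamma>\<^esub> z, \<xi> (x, y, z))),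
     LUnit = (\<lambda>x. (x, \<zero>\<^bsub>A\<^esub>)),
     RUnit = (\<lambda>x. (x, \<zero>\<^bsub>A\<^esub>))\<rparr>"

definition compatible_homs ::
    "('g, 'z) monoid_scheme \<Rightarrow> ('g, 'a, 'y) module_scheme
      \<Rightarrow> ('h, 'z') monoid_scheme \<Rightarrow> ('h, 'b, 'y') module_scheme
      \<Rightarrow> ('g \<Rightarrow> 'h) \<Rightarrow> ('a \<Rightarrow> 'b) \<Rightarrow> bool"
  where "compatible_homs \<Gamma> A \<Gamma>' A' \<phi> f \<longleftrightarrow>
    \<phi> \<in> hom \<Gamma> \<Gamma>' \<and> f \<in> hom (add_monoid A) (add_monoid A') \<and>
    (\<forall>x \<in> carrier \<Gamma>. \<forall>a \<in> carrier A. f (x \<odot>\<^bsub>A\<^esub> a) = \<phi> x \<odot>\<^bsub>A'\<^esub> f a)"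

definition of_type ::
    "('g, 'z) monoid_scheme \<Rightarrow> ('g, 'a, 'y) module_scheme \<Rightarrow> ('g \<Rightarrow> 'h) \<Rightarrow> ('a \<Rightarrow> 'b)
      \<Rightarrow> ('g, 'g \<times> 'a, 'h, 'h \<times> 'b) mon_functor \<Rightarrow> bool"
  where "of_type \<Gamma> A \<phi> f F \<longleftrightarrow>
    (\<forall>x \<in> carrier \<Gamma>. FObj F x = \<phi> x) \<and>
    (\<forall>x \<in> carrier \<Gamma>. \<forall>u \<in> carrier A. FArr F (x, u) = (\<phi> x, f u))"

text \<open>The cochain \<open>\<phi>\<^sup>*\<xi>' - f\<^sub>*\<xi>\<close>.\<close>

definition obstruction_cochain ::
    "('g, 'z) monoid_scheme \<Rightarrow> ('g \<times> 'g \<times> 'g \<Rightarrow> 'a)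
      \<Rightarrow> ('h, 'b, 'y) module_scheme \<Rightarrow> ('h \<times> 'h \<times> 'h \<Rightarrow> 'b)
      \<Rightarrow> ('g \<Rightarrow> 'h) \<Rightarrow> ('a \<Rightarrow> 'b) \<Rightarrow> ('g \<times> 'g \<times> 'g \<Rightarrow> 'b)"
  where "obstruction_cochain \<Gamma> \<xi> A' \<xi>' \<phi> f =
    (\<lambda>(x, y, z) \<in> carrier \<Gamma> \<times> carrier \<Gamma> \<times> carrier \<Gamma>. \<xi>' (\<phi> x, \<phi> y, \<phi> z) \<ominus>\<^bsub>A'\<^esub> f (\<xi> (x, y, z)))"

definition gr_functors_of_type ::
    "('g, 'z) monoid_scheme \<Rightarrow> ('g, 'a, 'y) module_scheme \<Rightarrow> ('g \<times> 'g \<times> 'g \<Rightarrow> 'a)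
      \<Rightarrow> ('h, 'z') monoid_scheme \<Rightarrow> ('h, 'b, 'y') module_scheme \<Rightarrow> ('h \<times> 'h \<times> 'h \<Rightarrow> 'b)
      \<Rightarrow> ('g \<Rightarrow> 'h) \<Rightarrow> ('a \<Rightarrow> 'b) \<Rightarrow> ('g, 'g \<times> 'a, 'h, 'h \<times> 'b) mon_functor set"
  where "gr_functors_of_type \<Gamma> A \<xi> \<Gamma>' A' \<xi>' \<phi> f =
    {F. gr_functor (gr_cat \<Gamma> A \<xi>) (gr_cat \<Gamma>' A' \<xi>') F \<and> of_type \<Gamma> A \<phi> f F}"

definition congruence_classes ::
    "('g, 'z) monoid_scheme \<Rightarrow> ('g, 'a, 'y) module_scheme \<Rightarrow> ('g \<times> 'g \<times> 'g \<Rightarrow> 'a)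
      \<Rightarrow> ('h, 'z') monoid_scheme \<Rightarrow> ('h, 'b, 'y') module_scheme \<Rightarrow> ('h \<times> 'h \<times> 'h \<Rightarrow> 'b)
      \<Rightarrow> ('g \<Rightarrow> 'h) \<Rightarrow> ('a \<Rightarrow> 'b) \<Rightarrow> ('g, 'g \<times> 'a, 'h, 'h \<times> 'b) mon_functor set set"
  where "congruence_classes \<Gamma> A \<xi> \<Gamma>' A' \<xi>' \<phi> f =
    gr_functors_of_type \<Gamma> A \<xi> \<Gamma>' A' \<xi>' \<phi> f //
      {(F, G). F \<in> gr_functors_of_type \<Gamma> A \<xi> \<Gamma>' A' \<xi>' \<phi> f \<and>
               G \<in> gr_functors_of_type \<Gamma> A \<xi> \<Gamma>' A' \<xi>' \<phi> f \<and>
               congruent_functors (gr_cat \<Gamma> A \<xi>) (gr_cat \<Gamma>' A' \<xi>') F G}"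

lemma group_module_pullback:
  assumes "group_module \<Gamma>' A'" "group \<Gamma>" "\<phi> \<in> hom \<Gamma> \<Gamma>'"
  shows "group_module \<Gamma> (pullback_module \<phi> A')"
proof -
  interpret N: group_module \<Gamma>' A' by fact
  interpret P: group \<Gamma> by fact
  have [simp]: "\<phi> x \<in> carrier \<Gamma>'" if "x \<in> carrier \<Gamma>" for x
    using assms(3) that by (auto simp: hom_def)
  have [simp]: "\<phi> \<one>\<^bsub>\<Gamma>\<^esub> = \<one>\<^bsub>\<Gamma>'\<^esub>"
    using assms by (simp add: hom_one N.is_group)
  have ab: "abelian_group (pullback_module \<phi> A')"
    by (rule abelian_groupI)
      (auto simp: pullback_module_def N.M.a_ac intro: N.M.l_neg N.M.a_inv_closed)
  show ?thesis
    using assms(3) ab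
    by (auto simp: group_module_def group_module_axioms_def P.is_group pullback_module_def hom_def
        N.act_closed N.act_add N.act_mult N.act_one)
qed

lemma gr_cat_sel [simp]:
  "Obj (gr_cat \<Gamma> A \<xi>) = carrier \<Gamma>"
  "Arr (gr_cat \<Gamma> A \<xi>) = carrier \<Gamma> \<times> carrier A"
  "Dom (gr_cat \<Gamma> A \<xi>) = fst"
  "Cod (gr_cat \<Gamma> A \<xi>) = fst"
  "Id (gr_cat \<Gamma> A \<xi>) x = (x, \<zero>\<^bsub>A\<^esub>)"
  "(x, u) \<cdot>\<^bsub>gr_cat \<Gamma> A \<xi>\<^esub> (y, v) = (x, u \<oplus>\<^bsub>A\<^esub> v)"
  "x \<boxdot>\<^bsub>gr_cat \<Gamma> A \<xi>\<^esub> y = x \<otimes>\<^bsub>\<Gamma>\<^esub> y"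
  "(x, u) \<boxtimes>\<^bsub>gr_cat \<Gamma> A \<xi>\<^esub> (y, v) = (x \<otimes>\<^bsub>\<Gamma>\<^esub> y, u \<oplus>\<^bsub>A\<^esub> x \<odot>\<^bsub>A\<^esub> v)"
  "Unit (gr_cat \<Gamma> A \<xi>) = \<one>\<^bsub>\<Gamma>\<^esub>"
  "Assoc (gr_cat \<Gamma> A \<xi>) x y z = (x \<otimes>\<^bsub>\<Gamma>\<^esub> y \<otimes>\<^bsub>\<Gamma>\<^esub> z, \<xi> (x, y, z))"
  "LUnit (gr_cat \<Gamma> A \<xi>) x = (x, \<zero>\<^bsub>A\<^esub>)"
  "RUnit (gr_cat \<Gamma> A \<xi>) x = (x, \<zero>\<^bsub>A\<^esub>)"
  by (simp_all add: gr_cat_def)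

lemma gr_category_gr_cat:
  assumes "group_module \<Gamma> A" "normalized_3_cocycle \<Gamma> A \<xi>"
  shows "gr_category (gr_cat \<Gamma> A \<xi>)"
proof -
  interpret N: group_module \<Gamma> A by fact
  let ?C = "gr_cat \<Gamma> A \<xi>"
  note act [simp] = N.act_closed N.act_add N.act_mult N.act_one
  have act0 [simp]: "x \<odot>\<^bsub>A\<^esub> \<zero>\<^bsub>A\<^esub> = \<zero>\<^bsub>A\<^esub>" if "x \<in> carrier \<Gamma>" for x
  proof -
    have "x \<odot>\<^bsub>A\<^esub> \<zero>\<^bsub>A\<^esub> = x \<odot>\<^bsub>A\<^esub> \<zero>\<^bsub>A\<^esub> \<oplus>\<^bsub>A\<^esub> x \<odot>\<^bsub>A\<^esub> \<zero>\<^bsub>A\<^esub>"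
      using N.act_add[OF that N.M.zero_closed N.M.zero_closed] by simp
    then show ?thesis
      using N.M.add.l_cancel_one' N.act_closed[OF that N.M.zero_closed] by metis
  qed
  have \<xi>_closed [simp]: "\<xi> (x, y, z) \<in> carrier A"
    if "x \<in> carrier \<Gamma>" "y \<in> carrier \<Gamma>" "z \<in> carrier \<Gamma>" for x y z
  proof -
    have "\<xi> \<in> (carrier \<Gamma> \<times> carrier \<Gamma> \<times> carrier \<Gamma>) \<rightarrow>\<^sub>E carrier A"
      using assms(2)
      by (simp add: normalized_3_cocycle_def Z3_def kernel_def cochains3_def product_group_def)
    from PiE_mem[OF this, of "(x, y, z)"] that show ?thesis by simp
  qed
  have norm [simp]: "\<xi> (x, \<one>\<^bsub>\<Gamma>\<^esub>, y) = \<zero>\<^bsub>A\<^esub>"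
    if "x \<in> carrier \<Gamma>" "y \<in> carrier \<Gamma>" for x y
    using assms(2) that by (auto simp: normalized_3_cocycle_def)
  have cocycle: "\<xi> (x \<otimes>\<^bsub>\<Gamma>\<^esub> y, z, t) \<oplus>\<^bsub>A\<^esub> \<xi> (x, y, z \<otimes>\<^bsub>\<Gamma>\<^esub> t)
      = \<xi> (x, y, z) \<oplus>\<^bsub>A\<^esub> (\<xi> (x, y \<otimes>\<^bsub>\<Gamma>\<^esub> z, t) \<oplus>\<^bsub>A\<^esub> x \<odot>\<^bsub>A\<^esub> \<xi> (y, z, t))"
    if c: "x \<in> carrier \<Gamma>" "y \<in> carrier \<Gamma>" "z \<in> carrier \<Gamma>" "t \<in> carrier \<Gamma>" for x y z t
  proof -
    let ?S = "carrier \<Gamma> \<times> carrier \<Gamma> \<times> carrier \<Gamma> \<times> carrier \<Gamma>"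
    have "coboundary3 \<Gamma> A \<xi> = (\<lambda>_ \<in> ?S. \<zero>\<^bsub>A\<^esub>)"
      using assms(2)
      by (simp add: normalized_3_cocycle_def Z3_def kernel_def cochains4_def product_group_def)
    then have "coboundary3 \<Gamma> A \<xi> (x, y, z, t) = \<zero>\<^bsub>A\<^esub>" using c by simp
    then have e: "x \<odot>\<^bsub>A\<^esub> \<xi> (y, z, t) \<ominus>\<^bsub>A\<^esub> \<xi> (x \<otimes>\<^bsub>\<Gamma>\<^esub> y, z, t) \<oplus>\<^bsub>A\<^esub> \<xi> (x, y \<otimes>\<^bsub>\<Gamma>\<^esub> z, t)
        \<ominus>\<^bsub>A\<^esub> \<xi> (x, y, z \<otimes>\<^bsub>\<Gamma>\<^esub> t) \<oplus>\<^bsub>A\<^esub> \<xi> (x, y, z) = \<zero>\<^bsub>A\<^esub>"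
      using c by (simp add: coboundary3_def)
    have *: "q \<oplus>\<^bsub>A\<^esub> s = u \<oplus>\<^bsub>A\<^esub> (r \<oplus>\<^bsub>A\<^esub> p)"
      if "p \<ominus>\<^bsub>A\<^esub> q \<oplus>\<^bsub>A\<^esub> r \<ominus>\<^bsub>A\<^esub> s \<oplus>\<^bsub>A\<^esub> u = \<zero>\<^bsub>A\<^esub>"
        "p \<in> carrier A" "q \<in> carrier A" "r \<in> carrier A" "s \<in> carrier A" "u \<in> carrier A"
      for p q r s u
    proof -
      have "(p \<ominus>\<^bsub>A\<^esub> q \<oplus>\<^bsub>A\<^esub> r \<ominus>\<^bsub>A\<^esub> s \<oplus>\<^bsub>A\<^esub> u) \<oplus>\<^bsub>A\<^esub> (q \<oplus>\<^bsub>A\<^esub> s)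
          = (u \<oplus>\<^bsub>A\<^esub> (r \<oplus>\<^bsub>A\<^esub> p)) \<oplus>\<^bsub>A\<^esub> (q \<oplus>\<^bsub>A\<^esub> \<ominus>\<^bsub>A\<^esub> q) \<oplus>\<^bsub>A\<^esub> (s \<oplus>\<^bsub>A\<^esub> \<ominus>\<^bsub>A\<^esub> s)"
        using that(2-) by (simp add: a_minus_def N.M.a_ac del: N.M.r_neg N.M.add.r_inv)
      also have "\<dots> = u \<oplus>\<^bsub>A\<^esub> (r \<oplus>\<^bsub>A\<^esub> p)"
        using that(2-) by (simp add: N.M.r_neg)
      finally have "(p \<ominus>\<^bsub>A\<^esub> q \<oplus>\<^bsub>A\<^esub> r \<ominus>\<^bsub>A\<^esub> s \<oplus>\<^bsub>A\<^esub> u) \<oplus>\<^bsub>A\<^esub> (q \<oplus>\<^bsub>A\<^esub> s) = u \<oplus>\<^bsub>A\<^esub> (r \<oplus>\<^bsub>A\<^esub> p)" .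
      then show ?thesis using that by simp
    qed
    show ?thesis by (rule * [OF e]) (use c in simp_all)
  qed
  have hom_iff: "h \<in> Hom ?C X Y \<longleftrightarrow> X = Y \<and> X \<in> carrier \<Gamma> \<and> (\<exists>u \<in> carrier A. h = (X, u))"
    for h X Y
    by (cases h) (auto simp: Hom_def)
  have iso: "is_iso_arr ?C (x, u)" if c: "x \<in> carrier \<Gamma>" "u \<in> carrier A" for x u
    unfolding is_iso_arr_def
  proof (intro conjI bexI)
    show "(x, \<ominus>\<^bsub>A\<^esub> u) \<in> Hom ?C (Cod ?C (x, u)) (Dom ?C (x, u))"
      using c by (simp add: hom_iff)
  qed (use c in \<open>simp_all add: N.M.l_neg N.M.r_neg\<close>)
  show ?thesis
  proof unfold_locales
    fix X assume X: "X \<in> Obj ?C"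
    then show "\<exists>Y \<in> Obj ?C. isomorphic_objs ?C (X \<boxdot>\<^bsub>?C\<^esub> Y) (Unit ?C) \<and>
        isomorphic_objs ?C (Y \<boxdot>\<^bsub>?C\<^esub> X) (Unit ?C)"
      using iso[OF N.one_closed N.M.zero_closed]
      by (intro bexI[of _ "inv\<^bsub>\<Gamma>\<^esub> X"]) (auto simp: isomorphic_objs_def hom_iff)
  next
    fix X Y Z T assume "X \<in> Obj ?C" "Y \<in> Obj ?C" "Z \<in> Obj ?C" "T \<in> Obj ?C"
    then show "Assoc ?C (X \<boxdot>\<^bsub>?C\<^esub> Y) Z T \<cdot>\<^bsub>?C\<^esub> Assoc ?C X Y (Z \<boxdot>\<^bsub>?C\<^esub> T)
        = (Assoc ?C X Y Z \<boxtimes>\<^bsub>?C\<^esub> Id ?C T) \<cdot>\<^bsub>?C\<^esub>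
            (Assoc ?C X (Y \<boxdot>\<^bsub>?C\<^esub> Z) T \<cdot>\<^bsub>?C\<^esub> (Id ?C X \<boxtimes>\<^bsub>?C\<^esub> Assoc ?C Y Z T))"
      using cocycle[of X Y Z T] by (simp add: N.m_assoc)
  qed (auto simp: hom_iff iso N.m_assoc N.M.a_ac)
qed

end

theory Submission
  imports Defs
begin

text \<open>Fix a type \<open>(\<phi>, f)\<close>. The objects and arrows of a functor of this type are prescribed, so all that is
  left to choose are the tensor isomorphisms, which are automorphisms \<open>(\<phi> (x y), g (x, y))\<close>, and the unit
  isomorphism. Hence a Gr-functor gives a 2-cochain \<open>g\<close> with values in \<open>A'\<close>. The associativity coherence
  says that the coboundary of \<open>g\<close> is the obstruction \<open>\<phi>\<^sup>*\<xi>' - f\<^sub>*\<xi>\<close>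
  (\<open>coboundary2_eq_obstruction_iff\<close>), and the left unit coherence at the unit object determines the
  unit isomorphism; with this choice both unit coherences hold everywhere, as the 3-cocycles are
  normalized (\<open>coboundary2_eq_obstruction_units\<close>). So the cochains that occur form exactly one fibre of the second coboundary map (\<open>functor_cochain_image\<close>).

  In the same way a monoidal transformation between two functors \<open>F\<close> and \<open>G\<close> of this type is a 1-cochain
  \<open>t\<close>, and its tensor coherence says that the coboundary of \<open>t\<close> is the difference of the cochains of \<open>F\<close>
  and \<open>G\<close>; the remaining conditions follow (\<open>bij_betw_monoidal_isos\<close>).

  Both parts of the theorem can be read off from this. If the obstruction is a coboundary, the fibre is
  nonempty and so is a torsor under the 2-cocycles; two of its elements belong to congruent functors if
  and only if they differ by a coboundary, so after the choice of a base point the congruence classes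
  become the elements of the second cohomology group. For \<open>F = G\<close> the difference is zero, so the
  automorphisms of \<open>F\<close> are the 1-cocycles.\<close>

section \<open>Torsors and quotients\<close>

lemma bij_betw_quotient_image:
  "\<exists>b. bij_betw b (T // {(x, y). x \<in> T \<and> y \<in> T \<and> h x = h y}) (h ` T)"
proof
  let ?R = "{(x, y). x \<in> T \<and> y \<in> T \<and> h x = h y}"
  have val: "the_elem (h ` (?R `` {x})) = h x" if "x \<in> T" for x
  proof -
    have "h ` (?R `` {x}) = {h x}" using that by auto
    then show ?thesis by simp
  qed
  show "bij_betw (\<lambda>X. the_elem (h ` X)) (T // ?R) (h ` T)"
    unfolding bij_betw_def
  proof (intro conjI inj_onI)
    fix X Y assume "X \<in> T // ?R" "Y \<in> T // ?R" and eq: "the_elem (h ` X) = the_elem (h ` Y)"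
    then obtain x y where "x \<in> T" "X = ?R `` {x}" "y \<in> T" "Y = ?R `` {y}"
      by (metis (lifting) quotientE)
    with eq val show "X = Y" by auto
  next
    have "T // ?R = (\<lambda>x. ?R `` {x}) ` T" unfolding quotient_def by blast
    then show "(\<lambda>X. the_elem (h ` X)) ` (T // ?R) = h ` T"
      using val by (simp only: image_image cong: image_cong)
  qed
qed

text \<open>A fibre of a homomorphism is a torsor under the kernel, so a choice of base point \<open>g0\<close>
  identifies the two. Applied to the second coboundary, \<open>g0\<close> is a cochain that bounds the obstruction.\<close>

lemma (in group_hom) fibre_minus_basepoint_image:
  assumes "g0 \<in> carrier G"
  shows "(\<lambda>g. g \<otimes> inv g0) ` {g \<in> carrier G. h g = h g0} = kernel G H h"
proof (intro equalityI subsetI)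
  fix z assume "z \<in> (\<lambda>g. g \<otimes> inv g0) ` {g \<in> carrier G. h g = h g0}"
  then show "z \<in> kernel G H h" using assms by (auto simp: kernel_def)
next
  fix z assume "z \<in> kernel G H h"
  then have "z \<otimes> g0 \<in> {g \<in> carrier G. h g = h g0}" "z = (z \<otimes> g0) \<otimes> inv g0"
    using assms by (auto simp: kernel_def G.m_assoc)
  then show "z \<in> (\<lambda>g. g \<otimes> inv g0) ` {g \<in> carrier G. h g = h g0}" by blast
qed

text \<open>Passing from a fibre to cosets of \<open>H\<close> identifies exactly the elements that differ by \<open>H\<close>: the
  base point cancels.\<close>

lemma (in group) coset_minus_basepoint_eq_iff:
  assumes "subgroup H G" "x \<in> carrier G" "y \<in> carrier G" "z \<in> carrier G"
  shows "H #> (x \<otimes> inv z) = H #> (y \<otimes> inv z) \<longleftrightarrow> x \<otimes> inv y \<in> H"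
proof -
  have "H #> (x \<otimes> inv z) = H #> (y \<otimes> inv z) \<longleftrightarrow> x \<otimes> inv z \<in> H #> (y \<otimes> inv z)"
    using assms repr_independence repr_independenceD by (metis inv_closed m_closed)
  also have "\<dots> \<longleftrightarrow> (x \<otimes> inv z) \<otimes> inv (y \<otimes> inv z) \<in> H"
    using assms by (intro subgroup.rcos_module is_group) auto
  also have "(x \<otimes> inv z) \<otimes> inv (y \<otimes> inv z) = x \<otimes> inv y"
    using assms by (simp add: inv_mult_group m_assoc) (simp add: m_assoc[symmetric])
  finally show ?thesis .
qed

section \<open>Cochains\<close>

text \<open>These rules, used from left to right, clear an equation of all subtractions, so that the cocycle
  identities can be compared with the coherence diagrams, in which only sums occur.\<close>

context abelian_group
begin

lemma minus_eq_iff: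
  "\<lbrakk>a \<in> carrier G; b \<in> carrier G; c \<in> carrier G\<rbrakk> \<Longrightarrow> a \<ominus> b = c \<longleftrightarrow> a = c \<oplus> b"
  by (auto simp: a_minus_def add.m_assoc r_neg l_neg)

lemma eq_minus_iff:
  "\<lbrakk>a \<in> carrier G; b \<in> carrier G; c \<in> carrier G\<rbrakk> \<Longrightarrow> c = a \<ominus> b \<longleftrightarrow> c \<oplus> b = a"
  using minus_eq_iff[of a b c] by auto

lemma minus_add_swap:
  "\<lbrakk>a \<in> carrier G; b \<in> carrier G; c \<in> carrier G\<rbrakk> \<Longrightarrow> a \<ominus> b \<oplus> c = (a \<oplus> c) \<ominus> b"
  by (simp add: a_minus_def a_ac)

lemma add_minus_assoc:
  "\<lbrakk>a \<in> carrier G; b \<in> carrier G; c \<in> carrier G\<rbrakk> \<Longrightarrow> c \<oplus> (a \<ominus> b) = (c \<oplus> a) \<ominus> b"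
  by (simp add: a_minus_def a_ac)

lemmas move_minus = minus_eq_iff eq_minus_iff minus_add_swap add_minus_assoc

end

context group_module
begin

lemma act_zero: "x \<in> carrier \<Gamma> \<Longrightarrow> x \<odot>\<^bsub>M\<^esub> \<zero>\<^bsub>M\<^esub> = \<zero>\<^bsub>M\<^esub>"
  using act_add[of x "\<zero>\<^bsub>M\<^esub>" "\<zero>\<^bsub>M\<^esub>"] act_closed[of x "\<zero>\<^bsub>M\<^esub>"] by simp

lemma act_minus:
  assumes "x \<in> carrier \<Gamma>" "a \<in> carrier M"
  shows "x \<odot>\<^bsub>M\<^esub> (\<ominus>\<^bsub>M\<^esub> a) = \<ominus>\<^bsub>M\<^esub> (x \<odot>\<^bsub>M\<^esub> a)"
proof (rule M.minus_equality[symmetric])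
  show "x \<odot>\<^bsub>M\<^esub> (\<ominus>\<^bsub>M\<^esub> a) \<oplus>\<^bsub>M\<^esub> x \<odot>\<^bsub>M\<^esub> a = \<zero>\<^bsub>M\<^esub>"
    using assms act_add[of x "\<ominus>\<^bsub>M\<^esub> a" a] by (simp add: M.l_neg act_zero)
qed (use assms act_closed in auto)

lemma group_cochains:
  "group (cochains1 \<Gamma> M)" "group (cochains2 \<Gamma> M)" "group (cochains3 \<Gamma> M)"
  by (simp_all add: cochains1_def cochains2_def cochains3_def M.a_group)

text \<open>Because the coboundaries are homomorphisms, \<open>B2\<close> is a subgroup of the 2-cochains and the cochains
  with a prescribed coboundary form a torsor.\<close>

lemma coboundary1_hom: "group_hom (cochains1 \<Gamma> M) (cochains2 \<Gamma> M) (coboundary1 \<Gamma> M)"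
proof (intro group_hom.intro group_hom_axioms.intro group_cochains homI)
  fix c assume "c \<in> carrier (cochains1 \<Gamma> M)"
  then show "coboundary1 \<Gamma> M c \<in> carrier (cochains2 \<Gamma> M)"
    by (auto simp: cochains1_def cochains2_def coboundary1_def
        intro!: act_closed M.minus_closed M.add.m_closed)
next
  fix c d assume "c \<in> carrier (cochains1 \<Gamma> M)" "d \<in> carrier (cochains1 \<Gamma> M)"
  then have [simp]: "c x \<in> carrier M" "d x \<in> carrier M" if "x \<in> carrier \<Gamma>" for x
    using that by (auto simp: cochains1_def)
  show "coboundary1 \<Gamma> M (c \<otimes>\<^bsub>cochains1 \<Gamma> M\<^esub> d)
      = coboundary1 \<Gamma> M c \<otimes>\<^bsub>cochains2 \<Gamma> M\<^esub> coboundary1 \<Gamma> M d"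
    by (rule ext) (auto simp: cochains1_def cochains2_def coboundary1_def act_closed act_add
        a_minus_def M.minus_add M.a_ac)
qed

lemma coboundary2_hom: "group_hom (cochains2 \<Gamma> M) (cochains3 \<Gamma> M) (coboundary2 \<Gamma> M)"
proof (intro group_hom.intro group_hom_axioms.intro group_cochains homI)
  fix c assume "c \<in> carrier (cochains2 \<Gamma> M)"
  then show "coboundary2 \<Gamma> M c \<in> carrier (cochains3 \<Gamma> M)"
    by (auto simp: cochains2_def cochains3_def coboundary2_def
        intro!: act_closed M.minus_closed M.add.m_closed)
next
  fix c d assume "c \<in> carrier (cochains2 \<Gamma> M)" "d \<in> carrier (cochains2 \<Gamma> M)"
  then have [simp]: "c (x, y) \<in> carrier M" "d (x, y) \<in> carrier M"
    if "x \<in> carrier \<Gamma>" "y \<in> carrier \<Gamma>" for x y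
    using that by (auto simp: cochains2_def)
  show "coboundary2 \<Gamma> M (c \<otimes>\<^bsub>cochains2 \<Gamma> M\<^esub> d)
      = coboundary2 \<Gamma> M c \<otimes>\<^bsub>cochains3 \<Gamma> M\<^esub> coboundary2 \<Gamma> M d"
    by (rule ext) (auto simp: cochains2_def cochains3_def coboundary2_def act_closed act_add
        a_minus_def M.minus_add M.a_ac)
qed

lemma subgroup_B2: "subgroup (B2 \<Gamma> M) (cochains2 \<Gamma> M)"
  unfolding B2_def by (rule group_hom.img_is_subgroup[OF coboundary1_hom])

lemma carrier_H2:
  "carrier (H2 \<Gamma> M) = (\<lambda>z. B2 \<Gamma> M #>\<^bsub>cochains2 \<Gamma> M\<^esub> z)
     ` kernel (cochains2 \<Gamma> M) (cochains3 \<Gamma> M) (coboundary2 \<Gamma> M)"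
  by (simp add: H2_def carrier_FactGroup Z2_def)

text \<open>A vanishing obstruction thus supplies a base point in the fibre of cochains that define functors.\<close>

lemma class3_trivialD:
  assumes "k \<in> carrier (cochains3 \<Gamma> M)" "class3 \<Gamma> M k = \<one>\<^bsub>H3 \<Gamma> M\<^esub>"
  obtains c where "c \<in> carrier (cochains2 \<Gamma> M)" "coboundary2 \<Gamma> M c = k"
proof -
  interpret d2: group_hom "cochains2 \<Gamma> M" "cochains3 \<Gamma> M" "coboundary2 \<Gamma> M"
    by (rule coboundary2_hom)
  have B3: "subgroup (B3 \<Gamma> M) (cochains3 \<Gamma> M)"
    unfolding B3_def by (rule d2.img_is_subgroup)
  have "B3 \<Gamma> M #>\<^bsub>cochains3 \<Gamma> M\<^esub> k = B3 \<Gamma> M"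
    using assms(2) by (simp add: class3_def H3_def Z3_def)
  then have "k \<in> B3 \<Gamma> M"
    using d2.H.coset_join1 assms(1) B3 by blast
  then show thesis using that by (auto simp: B3_def)
qed

end

section \<open>The Gr-category of a cocycle\<close>

text \<open>All arrows are automorphisms, so an arrow with known endpoints is given by its second
  component.\<close>

lemma Hom_gr_cat:
  "h \<in> Hom (gr_cat \<Gamma> A \<xi>) X Y \<longleftrightarrow> X = Y \<and> X \<in> carrier \<Gamma> \<and> (\<exists>u \<in> carrier A. h = (X, u))"
  by (cases h) (auto simp: Hom_def)

lemma is_iso_arr_gr_cat:
  assumes "group_module \<Gamma> A" "normalized_3_cocycle \<Gamma> A \<xi>"
  shows "is_iso_arr (gr_cat \<Gamma> A \<xi>) h \<longleftrightarrow> h \<in> carrier \<Gamma> \<times> carrier A"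
  using gr_category.all_arr_iso[OF gr_category_gr_cat[OF assms], of h]
  by (auto simp: is_iso_arr_def)

lemma normalized_3_cocycle_closed:
  assumes "normalized_3_cocycle \<Gamma> A \<xi>" "x \<in> carrier \<Gamma>" "y \<in> carrier \<Gamma>" "z \<in> carrier \<Gamma>"
  shows "\<xi> (x, y, z) \<in> carrier A"
  using assms by (auto simp: normalized_3_cocycle_def Z3_def kernel_def cochains3_def)

lemma pullback_module_sel [simp]:
  "carrier (pullback_module \<phi> M) = carrier M"
  "add (pullback_module \<phi> M) = add M"
  "zero (pullback_module \<phi> M) = zero M"
  "smult (pullback_module \<phi> M) x a = \<phi> x \<odot>\<^bsub>M\<^esub> a"
  "a_inv (pullback_module \<phi> M) = a_inv M"
  "a_minus (pullback_module \<phi> M) = a_minus M"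
  by (simp_all add: pullback_module_def a_inv_def a_minus_def m_inv_def fun_eq_iff)

text \<open>The data of a type \<open>(\<phi>, f)\<close>. Locally, \<open>M\<close> is the module \<open>A'\<close> with \<open>\<Gamma>\<close> acting through \<open>\<phi>\<close>; only its
  action differs from that of \<open>A'\<close>, so its additive operations are rewritten to those of \<open>A'\<close>, which
  are the ones that compute composition and tensor product in the target category.\<close>

locale compatible_gr_cats =
  S: group_module \<Gamma> A + T: group_module \<Gamma>' A'
  for \<Gamma> :: "('g, 'z) monoid_scheme" and A :: "('g, 'a, 'y) module_scheme"
    and \<Gamma>' :: "('h, 'z') monoid_scheme" and A' :: "('h, 'b, 'y') module_scheme" +
  fixes \<xi> :: "'g \<times> 'g \<times> 'g \<Rightarrow> 'a" and \<xi>' :: "'h \<times> 'h \<times> 'h \<Rightarrow> 'b"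
    and \<phi> :: "'g \<Rightarrow> 'h" and f :: "'a \<Rightarrow> 'b"
  assumes cocycle: "normalized_3_cocycle \<Gamma> A \<xi>"
    and cocycle': "normalized_3_cocycle \<Gamma>' A' \<xi>'"
    and compatible: "compatible_homs \<Gamma> A \<Gamma>' A' \<phi> f"
begin

abbreviation "M \<equiv> pullback_module \<phi> A'"
abbreviation "C \<equiv> gr_cat \<Gamma> A \<xi>"
abbreviation "D \<equiv> gr_cat \<Gamma>' A' \<xi>'"
abbreviation "C1 \<equiv> cochains1 \<Gamma> M"
abbreviation "C2 \<equiv> cochains2 \<Gamma> M"
abbreviation "C3 \<equiv> cochains3 \<Gamma> M"
abbreviation "d1 \<equiv> coboundary1 \<Gamma> M"
abbreviation "d2 \<equiv> coboundary2 \<Gamma> M"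
abbreviation "obstruction \<equiv> obstruction_cochain \<Gamma> \<xi> A' \<xi>' \<phi> f"
abbreviation "functors \<equiv> gr_functors_of_type \<Gamma> A \<xi> \<Gamma>' A' \<xi>' \<phi> f"

sublocale M: group_module \<Gamma> M
  rewrites "carrier M = carrier A'" and "add M = add A'" and "zero M = zero A'"
    and "a_inv M = a_inv A'" and "a_minus M = a_minus A'"
  by (rule group_module_pullback)
    (use compatible S.is_group T.group_module_axioms in \<open>auto simp: compatible_homs_def\<close>)

lemma \<phi>_hom:
  "x \<in> carrier \<Gamma> \<Longrightarrow> \<phi> x \<in> carrier \<Gamma>'"
  "\<lbrakk>x \<in> carrier \<Gamma>; y \<in> carrier \<Gamma>\<rbrakk> \<Longrightarrow> \<phi> (x \<otimes>\<^bsub>\<Gamma>\<^esub> y) = \<phi> x \<otimes>\<^bsub>\<Gamma>'\<^esub> \<phi> y"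
  "\<phi> \<one>\<^bsub>\<Gamma>\<^esub> = \<one>\<^bsub>\<Gamma>'\<^esub>"
  using compatible hom_one[OF _ S.is_group T.is_group, of \<phi>]
  by (auto simp: compatible_homs_def hom_def)

lemma f_hom:
  "a \<in> carrier A \<Longrightarrow> f a \<in> carrier A'"
  "\<lbrakk>a \<in> carrier A; b \<in> carrier A\<rbrakk> \<Longrightarrow> f (a \<oplus>\<^bsub>A\<^esub> b) = f a \<oplus>\<^bsub>A'\<^esub> f b"
  "f \<zero>\<^bsub>A\<^esub> = \<zero>\<^bsub>A'\<^esub>"
  "\<lbrakk>x \<in> carrier \<Gamma>; a \<in> carrier A\<rbrakk> \<Longrightarrow> f (x \<odot>\<^bsub>A\<^esub> a) = \<phi> x \<odot>\<^bsub>A'\<^esub> f a"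
  using compatible hom_one[OF _ S.M.a_group T.M.a_group, of f]
  by (auto simp: compatible_homs_def hom_def)

lemmas hom_simps = \<phi>_hom f_hom
lemmas act_simps = T.act_closed T.act_add T.act_mult T.act_one T.act_zero T.act_minus
lemmas \<xi>_simps = normalized_3_cocycle_closed[OF cocycle] normalized_3_cocycle_closed[OF cocycle']

lemma C1_iff: "t \<in> carrier C1 \<longleftrightarrow> t \<in> carrier \<Gamma> \<rightarrow>\<^sub>E carrier A'"
  by (simp add: cochains1_def)

lemma C2_iff: "g \<in> carrier C2 \<longleftrightarrow> g \<in> carrier \<Gamma> \<times> carrier \<Gamma> \<rightarrow>\<^sub>E carrier A'"
  by (simp add: cochains2_def)

lemma obstruction_closed: "obstruction \<in> carrier C3"
  by (auto simp: cochains3_def obstruction_cochain_def hom_simps \<xi>_simps)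

text \<open>The right hand side is the associativity coherence of a monoidal functor whose structure
  isomorphisms have second components \<open>g (x, y)\<close>.\<close>

lemma coboundary2_eq_obstruction_iff:
  assumes "g \<in> carrier C2"
  shows "d2 g = obstruction \<longleftrightarrow> (\<forall>x\<in>carrier \<Gamma>. \<forall>y\<in>carrier \<Gamma>. \<forall>z\<in>carrier \<Gamma>.
    f (\<xi> (x, y, z)) \<oplus>\<^bsub>A'\<^esub> (g (x, y \<otimes>\<^bsub>\<Gamma>\<^esub> z) \<oplus>\<^bsub>A'\<^esub> \<phi> x \<odot>\<^bsub>A'\<^esub> g (y, z))
      = g (x \<otimes>\<^bsub>\<Gamma>\<^esub> y, z) \<oplus>\<^bsub>A'\<^esub> (g (x, y) \<oplus>\<^bsub>A'\<^esub> \<xi>' (\<phi> x, \<phi> y, \<phi> z)))"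
proof -
  have g: "g (x, y) \<in> carrier A'" if "x \<in> carrier \<Gamma>" "y \<in> carrier \<Gamma>" for x y
    using assms that by (auto simp: C2_iff)
  have "d2 g = obstruction \<longleftrightarrow> (\<forall>x\<in>carrier \<Gamma>. \<forall>y\<in>carrier \<Gamma>. \<forall>z\<in>carrier \<Gamma>.
      d2 g (x, y, z) = obstruction (x, y, z))"
    by (auto simp: fun_eq_iff coboundary2_def obstruction_cochain_def)
  also have "\<dots> \<longleftrightarrow> (\<forall>x\<in>carrier \<Gamma>. \<forall>y\<in>carrier \<Gamma>. \<forall>z\<in>carrier \<Gamma>.
    f (\<xi> (x, y, z)) \<oplus>\<^bsub>A'\<^esub> (g (x, y \<otimes>\<^bsub>\<Gamma>\<^esub> z) \<oplus>\<^bsub>A'\<^esub> \<phi> x \<odot>\<^bsub>A'\<^esub> g (y, z))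
      = g (x \<otimes>\<^bsub>\<Gamma>\<^esub> y, z) \<oplus>\<^bsub>A'\<^esub> (g (x, y) \<oplus>\<^bsub>A'\<^esub> \<xi>' (\<phi> x, \<phi> y, \<phi> z)))"
    (is "_ \<longleftrightarrow> ?R")
    by (intro ball_cong refl)
      (auto simp: coboundary2_def obstruction_cochain_def g hom_simps act_simps \<xi>_simps
        T.M.move_minus T.M.a_ac)
  finally show ?thesis .
qed

text \<open>Normalization of \<open>\<xi>\<close> and \<open>\<xi>'\<close> controls \<open>g\<close> at the unit: in the associativity equation at \<open>(1, 1, x)\<close> and at \<open>(x, 1, 1)\<close> the terms with the 3-cocycles vanish. This is
  what makes both unit coherences hold with one and the same unit isomorphism.\<close>

lemma coboundary2_eq_obstruction_units:
  assumes g: "g \<in> carrier C2" and "d2 g = obstruction" and x: "x \<in> carrier \<Gamma>"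
  shows "g (\<one>\<^bsub>\<Gamma>\<^esub>, x) = g (\<one>\<^bsub>\<Gamma>\<^esub>, \<one>\<^bsub>\<Gamma>\<^esub>)"
    and "g (x, \<one>\<^bsub>\<Gamma>\<^esub>) = \<phi> x \<odot>\<^bsub>A'\<^esub> g (\<one>\<^bsub>\<Gamma>\<^esub>, \<one>\<^bsub>\<Gamma>\<^esub>)"
proof -
  have cl: "g (x, y) \<in> carrier A'" if "x \<in> carrier \<Gamma>" "y \<in> carrier \<Gamma>" for x y
    using g that by (auto simp: C2_iff)
  have norm: "\<xi> (\<one>\<^bsub>\<Gamma>\<^esub>, \<one>\<^bsub>\<Gamma>\<^esub>, x) = \<zero>\<^bsub>A\<^esub>" "\<xi> (x, \<one>\<^bsub>\<Gamma>\<^esub>, \<one>\<^bsub>\<Gamma>\<^esub>) = \<zero>\<^bsub>A\<^esub>"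
    "\<xi>' (\<one>\<^bsub>\<Gamma>'\<^esub>, \<one>\<^bsub>\<Gamma>'\<^esub>, \<phi> x) = \<zero>\<^bsub>A'\<^esub>" "\<xi>' (\<phi> x, \<one>\<^bsub>\<Gamma>'\<^esub>, \<one>\<^bsub>\<Gamma>'\<^esub>) = \<zero>\<^bsub>A'\<^esub>"
    using cocycle cocycle' x by (auto simp: normalized_3_cocycle_def \<phi>_hom)
  note eq = coboundary2_eq_obstruction_iff[OF g, THEN iffD1, rule_format, OF assms(2)]
  show "g (\<one>\<^bsub>\<Gamma>\<^esub>, x) = g (\<one>\<^bsub>\<Gamma>\<^esub>, \<one>\<^bsub>\<Gamma>\<^esub>)"
    using eq[of "\<one>\<^bsub>\<Gamma>\<^esub>" "\<one>\<^bsub>\<Gamma>\<^esub>" x] x by (simp add: norm cl hom_simps act_simps)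
  show "g (x, \<one>\<^bsub>\<Gamma>\<^esub>) = \<phi> x \<odot>\<^bsub>A'\<^esub> g (\<one>\<^bsub>\<Gamma>\<^esub>, \<one>\<^bsub>\<Gamma>\<^esub>)"
    using eq[of x "\<one>\<^bsub>\<Gamma>\<^esub>" "\<one>\<^bsub>\<Gamma>\<^esub>"] x by (simp add: norm cl hom_simps act_simps)
qed

section \<open>Gr-functors as cochains\<close>

definition functor_cochain :: "('g, 'g \<times> 'a, 'h, 'h \<times> 'b) mon_functor \<Rightarrow> 'g \<times> 'g \<Rightarrow> 'b"
  where "functor_cochain F = (\<lambda>p \<in> carrier \<Gamma> \<times> carrier \<Gamma>. snd (FTensor F p))"

text \<open>The functor with tensor isomorphisms \<open>g\<close>; the unit isomorphism must cancel \<open>g\<close> at the pair of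
  units, by the left unit coherence.\<close>

definition cochain_functor :: "('g \<times> 'g \<Rightarrow> 'b) \<Rightarrow> ('g, 'g \<times> 'a, 'h, 'h \<times> 'b) mon_functor"
  where "cochain_functor g =
    \<lparr>FObj = (\<lambda>x \<in> carrier \<Gamma>. \<phi> x),
     FArr = (\<lambda>(x, u) \<in> carrier \<Gamma> \<times> carrier A. (\<phi> x, f u)),
     FTensor = (\<lambda>(x, y) \<in> carrier \<Gamma> \<times> carrier \<Gamma>. (\<phi> (x \<otimes>\<^bsub>\<Gamma>\<^esub> y), g (x, y))),
     FUnit = (\<one>\<^bsub>\<Gamma>'\<^esub>, \<ominus>\<^bsub>A'\<^esub> g (\<one>\<^bsub>\<Gamma>\<^esub>, \<one>\<^bsub>\<Gamma>\<^esub>))\<rparr>"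

lemma functors_sel:
  assumes "F \<in> functors"
  shows "x \<in> carrier \<Gamma> \<Longrightarrow> FObj F x = \<phi> x"
    and "\<lbrakk>x \<in> carrier \<Gamma>; u \<in> carrier A\<rbrakk> \<Longrightarrow> FArr F (x, u) = (\<phi> x, f u)"
    and "\<lbrakk>x \<in> carrier \<Gamma>; y \<in> carrier \<Gamma>\<rbrakk>
      \<Longrightarrow> FTensor F (x, y) = (\<phi> x \<otimes>\<^bsub>\<Gamma>'\<^esub> \<phi> y, functor_cochain F (x, y))"
    and "functor_cochain F \<in> carrier C2"
proof -
  interpret F: gr_functor C D F
    using assms by (simp add: gr_functors_of_type_def)
  show obj: "FObj F x = \<phi> x" if "x \<in> carrier \<Gamma>" for x
    using assms that by (simp add: gr_functors_of_type_def of_type_def)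
  show "FArr F (x, u) = (\<phi> x, f u)" if "x \<in> carrier \<Gamma>" "u \<in> carrier A" for x u
    using assms that by (simp add: gr_functors_of_type_def of_type_def)
  have T: "\<exists>u \<in> carrier A'. FTensor F (x, y) = (\<phi> x \<otimes>\<^bsub>\<Gamma>'\<^esub> \<phi> y, u)"
    if "x \<in> carrier \<Gamma>" "y \<in> carrier \<Gamma>" for x y
    using F.FTensor_Hom[of x y] that by (simp add: Hom_gr_cat obj \<phi>_hom)
  then show "FTensor F (x, y) = (\<phi> x \<otimes>\<^bsub>\<Gamma>'\<^esub> \<phi> y, functor_cochain F (x, y))"
    if "x \<in> carrier \<Gamma>" "y \<in> carrier \<Gamma>" for x y
    using that by (fastforce simp: functor_cochain_def)
  show "functor_cochain F \<in> carrier C2"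
    using T by (fastforce simp: C2_iff functor_cochain_def)
qed

lemma coboundary_functor_cochain:
  assumes "F \<in> functors"
  shows "d2 (functor_cochain F) = obstruction"
proof -
  interpret F: gr_functor C D F
    using assms by (simp add: gr_functors_of_type_def)
  note sel = functors_sel[OF assms]
  have cl: "functor_cochain F (x, y) \<in> carrier A'" if "x \<in> carrier \<Gamma>" "y \<in> carrier \<Gamma>" for x y
    using sel(4) that by (auto simp: C2_iff)
  show ?thesis
    unfolding coboundary2_eq_obstruction_iff[OF sel(4)]
  proof (intro ballI)
    fix x y z assume "x \<in> carrier \<Gamma>" "y \<in> carrier \<Gamma>" "z \<in> carrier \<Gamma>"
    then show "f (\<xi> (x, y, z)) \<oplus>\<^bsub>A'\<^esub> (functor_cochain F (x, y \<otimes>\<^bsub>\<Gamma>\<^esub> z)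
          \<oplus>\<^bsub>A'\<^esub> \<phi> x \<odot>\<^bsub>A'\<^esub> functor_cochain F (y, z))
        = functor_cochain F (x \<otimes>\<^bsub>\<Gamma>\<^esub> y, z)
          \<oplus>\<^bsub>A'\<^esub> (functor_cochain F (x, y) \<oplus>\<^bsub>A'\<^esub> \<xi>' (\<phi> x, \<phi> y, \<phi> z))"
      using F.F_assoc[of x y z] by (simp add: sel cl hom_simps act_simps \<xi>_simps)
  qed
qed

text \<open>The left unit coherence at the unit object leaves a single choice for the unit isomorphism.\<close>

lemma functors_FUnit:
  assumes "F \<in> functors"
  shows "FUnit F = (\<one>\<^bsub>\<Gamma>'\<^esub>, \<ominus>\<^bsub>A'\<^esub> functor_cochain F (\<one>\<^bsub>\<Gamma>\<^esub>, \<one>\<^bsub>\<Gamma>\<^esub>))"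
proof -
  interpret F: gr_functor C D F
    using assms by (simp add: gr_functors_of_type_def)
  note sel = functors_sel[OF assms]
  have cl: "functor_cochain F (\<one>\<^bsub>\<Gamma>\<^esub>, \<one>\<^bsub>\<Gamma>\<^esub>) \<in> carrier A'"
    using sel(4) by (auto simp: C2_iff)
  obtain c where c: "c \<in> carrier A'" "FUnit F = (\<one>\<^bsub>\<Gamma>'\<^esub>, c)"
    using F.FUnit_Hom by (auto simp: Hom_gr_cat)
  have "functor_cochain F (\<one>\<^bsub>\<Gamma>\<^esub>, \<one>\<^bsub>\<Gamma>\<^esub>) \<oplus>\<^bsub>A'\<^esub> c = \<zero>\<^bsub>A'\<^esub>"
    using F.F_left_unit[of "\<one>\<^bsub>\<Gamma>\<^esub>"] c cl by (simp add: sel hom_simps act_simps)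
  then have "\<ominus>\<^bsub>A'\<^esub> functor_cochain F (\<one>\<^bsub>\<Gamma>\<^esub>, \<one>\<^bsub>\<Gamma>\<^esub>) = c"
    using c cl by (intro T.M.minus_equality) (auto simp: T.M.a_comm)
  with c show ?thesis by simp
qed

lemma cochain_functor_in_functors:
  assumes g: "g \<in> carrier C2" and eq: "d2 g = obstruction"
  shows "cochain_functor g \<in> functors"
proof -
  have cl: "g (x, y) \<in> carrier A'" if "x \<in> carrier \<Gamma>" "y \<in> carrier \<Gamma>" for x y
    using g that by (auto simp: C2_iff)
  note assoc = coboundary2_eq_obstruction_iff[OF g, THEN iffD1, rule_format, OF eq]
  note units = coboundary2_eq_obstruction_units[OF g eq]
  interpret C: gr_category C
    using S.group_module_axioms cocycle by (rule gr_category_gr_cat)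
  interpret D: gr_category D
    using T.group_module_axioms cocycle' by (rule gr_category_gr_cat)
  note iso = is_iso_arr_gr_cat[OF T.group_module_axioms cocycle']
  note simps = cochain_functor_def Hom_gr_cat cl hom_simps act_simps iso \<xi>_simps S.act_closed
    S.m_assoc T.m_assoc
  have "gr_functor C D (cochain_functor g)"
  proof (unfold_locales, goal_cases)
    \<comment> \<open>naturality of the tensor isomorphisms: \<open>f\<close> is equivariant along \<open>\<phi>\<close>\<close>
    case (9 h X X' k Y Y')
    then show ?case by (auto simp: simps T.M.a_ac)
  next
    \<comment> \<open>associativity coherence: the coboundary equation for \<open>g\<close>\<close>
    case (12 X Y Z)
    then show ?case using assoc[of X Y Z] by (simp add: simps)
  next
    \<comment> \<open>left unit coherence: \<open>g (1, x)\<close> cancels against the unit isomorphism\<close>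
    case (13 X)
    then show ?case using units(1)[of X] by (simp add: simps T.M.r_neg)
  next
    \<comment> \<open>right unit coherence: \<open>g (x, 1)\<close> cancels against the translate of the unit isomorphism\<close>
    case (14 X)
    then show ?case using units(2)[of X] by (simp add: simps T.M.r_neg)
  qed (auto simp: simps)
  then show ?thesis
    by (simp add: gr_functors_of_type_def of_type_def cochain_functor_def)
qed

lemma functor_cochain_cochain_functor:
  assumes "g \<in> carrier C2"
  shows "functor_cochain (cochain_functor g) = g"
  using assms by (force simp: functor_cochain_def cochain_functor_def C2_iff PiE_iff
      extensional_def fun_eq_iff)

lemma functor_cochain_image:
  "functor_cochain ` functors = {g \<in> carrier C2. d2 g = obstruction}"
proof (intro equalityI subsetI)
  fix g assume "g \<in> functor_cochain ` functors"
  then show "g \<in> {g \<in> carrier C2. d2 g = obstruction}"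
    using functors_sel(4) coboundary_functor_cochain by auto
next
  fix g assume "g \<in> {g \<in> carrier C2. d2 g = obstruction}"
  then show "g \<in> functor_cochain ` functors"
    by (auto intro!: rev_image_eqI[OF cochain_functor_in_functors]
        simp: functor_cochain_cochain_functor)
qed

section \<open>Monoidal isomorphisms as cochains\<close>

text \<open>The right hand side is the tensor coherence of a transformation with second components \<open>t x\<close>,
  from a functor with cochain \<open>g\<close> to a functor with cochain \<open>g'\<close>.\<close>

lemma coboundary1_eq_difference_iff:
  assumes t: "t \<in> carrier C1" and g: "g \<in> carrier C2" and g': "g' \<in> carrier C2"
  shows "d1 t = g \<otimes>\<^bsub>C2\<^esub> inv\<^bsub>C2\<^esub> g' \<longleftrightarrow> (\<forall>x\<in>carrier \<Gamma>. \<forall>y\<in>carrier \<Gamma>.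
    g' (x, y) \<oplus>\<^bsub>A'\<^esub> (t x \<oplus>\<^bsub>A'\<^esub> \<phi> x \<odot>\<^bsub>A'\<^esub> t y) = t (x \<otimes>\<^bsub>\<Gamma>\<^esub> y) \<oplus>\<^bsub>A'\<^esub> g (x, y))"
proof -
  have cl: "t x \<in> carrier A'" "g (x, y) \<in> carrier A'" "g' (x, y) \<in> carrier A'"
    if "x \<in> carrier \<Gamma>" "y \<in> carrier \<Gamma>" for x y
    using assms that by (auto simp: C1_iff C2_iff)
  have inv: "m_inv (add_monoid M) = a_inv A'"
    using pullback_module_sel(5) by (metis a_inv_def)
  have diff: "g \<otimes>\<^bsub>C2\<^esub> inv\<^bsub>C2\<^esub> g' = (\<lambda>p \<in> carrier \<Gamma> \<times> carrier \<Gamma>. g p \<ominus>\<^bsub>A'\<^esub> g' p)"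
    using g' M.M.a_group
    by (auto simp: cochains2_def fun_eq_iff a_minus_def inv[simplified])
  have "d1 t = g \<otimes>\<^bsub>C2\<^esub> inv\<^bsub>C2\<^esub> g' \<longleftrightarrow> (\<forall>x\<in>carrier \<Gamma>. \<forall>y\<in>carrier \<Gamma>.
      d1 t (x, y) = g (x, y) \<ominus>\<^bsub>A'\<^esub> g' (x, y))"
    unfolding diff by (auto simp: fun_eq_iff coboundary1_def)
  also have "\<dots> \<longleftrightarrow> (\<forall>x\<in>carrier \<Gamma>. \<forall>y\<in>carrier \<Gamma>.
      g' (x, y) \<oplus>\<^bsub>A'\<^esub> (t x \<oplus>\<^bsub>A'\<^esub> \<phi> x \<odot>\<^bsub>A'\<^esub> t y) = t (x \<otimes>\<^bsub>\<Gamma>\<^esub> y) \<oplus>\<^bsub>A'\<^esub> g (x, y))"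
    by (intro ball_cong refl)
      (auto simp: coboundary1_def cl hom_simps act_simps T.M.move_minus T.M.a_ac)
  finally show ?thesis .
qed

text \<open>The common source of both parts of the theorem. A monoidal transformation between functors of
  the same type has components \<open>(\<phi> x, t x)\<close>. These are invertible because \<open>A'\<close> is a group and natural
  because it is commutative, while the tensor coherence says that \<open>t\<close> bounds the difference of the two cochains.
  The unit coherence is the tensor coherence at the pair of unit objects.\<close>

lemma bij_betw_monoidal_isos:
  assumes F: "F \<in> functors" and G: "G \<in> functors"
  shows "bij_betw (\<lambda>\<alpha>. \<lambda>x \<in> carrier \<Gamma>. snd (\<alpha> x)) (monoidal_isos C D F G)
    {t \<in> carrier C1. d1 t = functor_cochain F \<otimes>\<^bsub>C2\<^esub> inv\<^bsub>C2\<^esub> functor_cochain G}"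
proof (rule bij_betw_byWitness[where f' = "\<lambda>t. \<lambda>x \<in> carrier \<Gamma>. (\<phi> x, t x)"])
  let ?I = "monoidal_isos C D F G"
  let ?N = "{t \<in> carrier C1. d1 t = functor_cochain F \<otimes>\<^bsub>C2\<^esub> inv\<^bsub>C2\<^esub> functor_cochain G}"
  let ?p = "\<lambda>\<alpha>. \<lambda>x \<in> carrier \<Gamma>. snd (\<alpha> x)"
  let ?q = "\<lambda>t. \<lambda>x \<in> carrier \<Gamma>. (\<phi> x, t x)"
  note selF = functors_sel[OF F] functors_FUnit[OF F]
  note selG = functors_sel[OF G] functors_FUnit[OF G]
  have cl: "functor_cochain F (x, y) \<in> carrier A'" "functor_cochain G (x, y) \<in> carrier A'"
    if "x \<in> carrier \<Gamma>" "y \<in> carrier \<Gamma>" for x y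
    using selF(4) selG(4) that by (auto simp: C2_iff)
  have comp: "\<alpha> \<in> extensional (carrier \<Gamma>)"
      "x \<in> carrier \<Gamma> \<Longrightarrow> \<exists>u \<in> carrier A'. \<alpha> x = (\<phi> x, u)" if "\<alpha> \<in> ?I" for \<alpha> x
  proof -
    interpret \<alpha>: monoidal_transformation C D F G \<alpha>
      using that by (simp add: monoidal_isos_def)
    show "\<alpha> \<in> extensional (carrier \<Gamma>)"
      using \<alpha>.components by (simp add: PiE_iff)
    show "\<exists>u \<in> carrier A'. \<alpha> x = (\<phi> x, u)" if "x \<in> carrier \<Gamma>"
      using PiE_mem[OF \<alpha>.components, of x] that by (simp add: Hom_gr_cat selF selG)
  qed
  show qp: "\<forall>\<alpha> \<in> ?I. ?q (?p \<alpha>) = \<alpha>"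
  proof (intro ballI ext)
    fix \<alpha> x assume "\<alpha> \<in> ?I"
    then show "?q (?p \<alpha>) x = \<alpha> x"
      using comp(1)[of \<alpha>] comp(2)[of \<alpha> x] by (auto simp: extensional_def)
  qed
  show "\<forall>t \<in> ?N. ?p (?q t) = t"
    by (auto simp: C1_iff PiE_iff extensional_def fun_eq_iff)
  show "?p ` ?I \<subseteq> ?N"
  proof clarify
    fix \<alpha> assume I: "\<alpha> \<in> ?I"
    define t where "t = ?p \<alpha>"
    then have \<alpha>: "\<alpha> x = (\<phi> x, t x)" if "x \<in> carrier \<Gamma>" for x
      using that comp(2)[OF I, of x] by auto
    have t: "t \<in> carrier C1"
      using comp(2)[OF I] by (fastforce simp: C1_iff t_def)
    interpret \<alpha>: monoidal_transformation C D F G \<alpha>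
      using I by (simp add: monoidal_isos_def)
    have "d1 t = functor_cochain F \<otimes>\<^bsub>C2\<^esub> inv\<^bsub>C2\<^esub> functor_cochain G"
      unfolding coboundary1_eq_difference_iff[OF t selF(4) selG(4)]
    proof (intro ballI)
      fix x y assume "x \<in> carrier \<Gamma>" "y \<in> carrier \<Gamma>"
      then show "functor_cochain G (x, y) \<oplus>\<^bsub>A'\<^esub> (t x \<oplus>\<^bsub>A'\<^esub> \<phi> x \<odot>\<^bsub>A'\<^esub> t y)
          = t (x \<otimes>\<^bsub>\<Gamma>\<^esub> y) \<oplus>\<^bsub>A'\<^esub> functor_cochain F (x, y)"
        using \<alpha>.tensor[of x y] by (simp add: \<alpha> selF selG hom_simps)
    qed
    with t show "?p \<alpha> \<in> carrier C1 \<and>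
        d1 (?p \<alpha>) = functor_cochain F \<otimes>\<^bsub>C2\<^esub> inv\<^bsub>C2\<^esub> functor_cochain G"
      by (simp only: t_def)
  qed
  show "?q ` ?N \<subseteq> ?I"
  proof clarify
    fix t assume t: "t \<in> carrier C1"
      and eq: "d1 t = functor_cochain F \<otimes>\<^bsub>C2\<^esub> inv\<^bsub>C2\<^esub> functor_cochain G"
    have tcl: "t x \<in> carrier A'" if "x \<in> carrier \<Gamma>" for x
      using t that by (auto simp: C1_iff)
    note tensor = coboundary1_eq_difference_iff[OF t selF(4) selG(4), THEN iffD1, rule_format,
      OF eq]
    have "functor_cochain G (\<one>\<^bsub>\<Gamma>\<^esub>, \<one>\<^bsub>\<Gamma>\<^esub>) \<oplus>\<^bsub>A'\<^esub> t \<one>\<^bsub>\<Gamma>\<^esub> = functor_cochain F (\<one>\<^bsub>\<Gamma>\<^esub>, \<one>\<^bsub>\<Gamma>\<^esub>)"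
      using tensor[of "\<one>\<^bsub>\<Gamma>\<^esub>" "\<one>\<^bsub>\<Gamma>\<^esub>"] cl[of "\<one>\<^bsub>\<Gamma>\<^esub>" "\<one>\<^bsub>\<Gamma>\<^esub>"] tcl[of "\<one>\<^bsub>\<Gamma>\<^esub>"]
      by (simp add: hom_simps act_simps T.M.a_lcomm)
    then have unit: "t \<one>\<^bsub>\<Gamma>\<^esub> \<ominus>\<^bsub>A'\<^esub> functor_cochain F (\<one>\<^bsub>\<Gamma>\<^esub>, \<one>\<^bsub>\<Gamma>\<^esub>)
        = \<ominus>\<^bsub>A'\<^esub> functor_cochain G (\<one>\<^bsub>\<Gamma>\<^esub>, \<one>\<^bsub>\<Gamma>\<^esub>)"
      using cl[of "\<one>\<^bsub>\<Gamma>\<^esub>" "\<one>\<^bsub>\<Gamma>\<^esub>"] tcl[of "\<one>\<^bsub>\<Gamma>\<^esub>"]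
      by (simp add: T.M.minus_eq_iff T.M.add.inv_solve_left)
    interpret F: gr_functor C D F using F by (simp add: gr_functors_of_type_def)
    interpret G: gr_functor C D G using G by (simp add: gr_functors_of_type_def)
    have "monoidal_transformation C D F G (?q t)"
    proof (unfold_locales, goal_cases)
      \<comment> \<open>components\<close>
      case 1
      then show ?case by (auto simp: Hom_gr_cat selF selG tcl hom_simps)
    next
      \<comment> \<open>naturality\<close>
      case (2 h X Y)
      then show ?case by (auto simp: Hom_gr_cat selF selG tcl hom_simps T.M.a_comm)
    next
      \<comment> \<open>tensor coherence\<close>
      case (3 X Y)
      then show ?case using tensor[of X Y] by (simp add: selF selG hom_simps)
    next
      \<comment> \<open>unit coherence\<close>
      case 4
      then show ?case using unit by (simp add: selF selG hom_simps a_minus_def)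
    qed
    then show "?q t \<in> ?I"
      by (simp add: monoidal_isos_def is_iso_arr_gr_cat[OF T.group_module_axioms cocycle']
          tcl hom_simps)
  qed
qed

lemma congruent_functors_iff:
  assumes "F \<in> functors" "G \<in> functors"
  shows "congruent_functors C D F G
    \<longleftrightarrow> functor_cochain F \<otimes>\<^bsub>C2\<^esub> inv\<^bsub>C2\<^esub> functor_cochain G \<in> B2 \<Gamma> M"
proof -
  let ?k = "functor_cochain F \<otimes>\<^bsub>C2\<^esub> inv\<^bsub>C2\<^esub> functor_cochain G"
  have "congruent_functors C D F G \<longleftrightarrow> {t \<in> carrier C1. d1 t = ?k} \<noteq> {}"
    unfolding congruent_functors_def
      bij_betw_imp_surj_on[OF bij_betw_monoidal_isos[OF assms], symmetric]
    by (simp only: image_is_empty)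
  also have "\<dots> \<longleftrightarrow> ?k \<in> d1 ` carrier C1"
  proof -
    have "{t \<in> carrier C1. d1 t = k} \<noteq> {} \<longleftrightarrow> k \<in> d1 ` carrier C1" for k by auto
    then show ?thesis .
  qed
  finally show ?thesis by (simp only: B2_def)
qed

text \<open>Sending a functor to the class of its cochain relative to a base cochain \<open>g0\<close> is onto \<open>H2\<close> since
  the cochains of functors form the whole fibre of \<open>g0\<close>, and it separates exactly the congruence classes.
  The bijection depends on \<open>g0\<close>.\<close>

lemma congruence_classes_bij_H2:
  assumes "class3 \<Gamma> M obstruction = \<one>\<^bsub>H3 \<Gamma> M\<^esub>"
  shows "\<exists>b. bij_betw b (congruence_classes \<Gamma> A \<xi> \<Gamma>' A' \<xi>' \<phi> f) (carrier (H2 \<Gamma> M))"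
proof -
  interpret d2: group_hom C2 C3 d2 by (rule M.coboundary2_hom)
  obtain g0 where g0: "g0 \<in> carrier C2" "d2 g0 = obstruction"
    using M.class3_trivialD[OF obstruction_closed assms] .
  define cls where "cls F = B2 \<Gamma> M #>\<^bsub>C2\<^esub> (functor_cochain F \<otimes>\<^bsub>C2\<^esub> inv\<^bsub>C2\<^esub> g0)" for F
  have "cls ` functors = (\<lambda>z. B2 \<Gamma> M #>\<^bsub>C2\<^esub> z) `
      (\<lambda>g. g \<otimes>\<^bsub>C2\<^esub> inv\<^bsub>C2\<^esub> g0) ` functor_cochain ` functors"
    by (simp add: cls_def image_image)
  also have "\<dots> = carrier (H2 \<Gamma> M)"
    using d2.fibre_minus_basepoint_image[OF g0(1)]
    by (simp add: functor_cochain_image g0(2) M.carrier_H2)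
  finally have image: "cls ` functors = carrier (H2 \<Gamma> M)" .
  have "congruent_functors C D F G \<longleftrightarrow> cls F = cls G" if "F \<in> functors" "G \<in> functors" for F G
    unfolding cls_def congruent_functors_iff[OF that]
    using d2.G.coset_minus_basepoint_eq_iff[OF M.subgroup_B2 functors_sel(4)[OF that(1)]
        functors_sel(4)[OF that(2)] g0(1)] by simp
  then have "congruence_classes \<Gamma> A \<xi> \<Gamma>' A' \<xi>' \<phi> f
      = functors // {(F, G). F \<in> functors \<and> G \<in> functors \<and> cls F = cls G}"
    unfolding congruence_classes_def by (intro arg_cong2[where f = quotient]) auto
  with bij_betw_quotient_image[of functors cls] image show ?thesis by simp
qed

text \<open>For equal functors the difference of the cochains is zero, so the automorphisms correspond to the
  kernel of the first coboundary.\<close>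

lemma Aut_bij_Z1:
  assumes "F \<in> functors"
  shows "bij_betw (\<lambda>\<alpha>. \<lambda>x \<in> carrier \<Gamma>. snd (\<alpha> x)) (Aut C D F) (carrier (Z1 \<Gamma> M))"
proof -
  interpret C2: group C2 by (rule M.group_cochains)
  have "carrier (Z1 \<Gamma> M) = {t \<in> carrier C1. d1 t = \<one>\<^bsub>C2\<^esub>}"
    by (simp add: Z1_def kernel_def)
  then show ?thesis
    using bij_betw_monoidal_isos[OF assms assms]
    by (simp only: Aut_def C2.r_inv[OF functors_sel(4)[OF assms]])
qed

end

theorem theorem7:
  fixes \<Gamma> :: "('g, 'z) monoid_scheme" and A :: "('g, 'a, 'y) module_scheme"
    and \<Gamma>' :: "('h, 'z') monoid_scheme" and A' :: "('h, 'b, 'y') module_scheme"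
    and \<xi> :: "'g \<times> 'g \<times> 'g \<Rightarrow> 'a" and \<xi>' :: "'h \<times> 'h \<times> 'h \<Rightarrow> 'b"
  assumes "group_module \<Gamma> A" and "normalized_3_cocycle \<Gamma> A \<xi>"
    and "group_module \<Gamma>' A'" and "normalized_3_cocycle \<Gamma>' A' \<xi>'"
  shows
    "(\<forall>\<phi> f. compatible_homs \<Gamma> A \<Gamma>' A' \<phi> f \<longrightarrow>
        class3 \<Gamma> (pullback_module \<phi> A') (obstruction_cochain \<Gamma> \<xi> A' \<xi>' \<phi> f)
          = \<one>\<^bsub>H3 \<Gamma> (pullback_module \<phi> A')\<^esub> \<longrightarrow>
        (\<exists>b. bij_betw b (congruence_classes \<Gamma> A \<xi> \<Gamma>' A' \<xi>' \<phi> f)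
                        (carrier (H2 \<Gamma> (pullback_module \<phi> A'))))) \<and>
     (\<forall>\<phi> f F. compatible_homs \<Gamma> A \<Gamma>' A' \<phi> f \<longrightarrow>
        gr_functor (gr_cat \<Gamma> A \<xi>) (gr_cat \<Gamma>' A' \<xi>') F \<longrightarrow>
        of_type \<Gamma> A \<phi> f F \<longrightarrow>
        (\<exists>b. bij_betw b (Aut (gr_cat \<Gamma> A \<xi>) (gr_cat \<Gamma>' A' \<xi>') F)
                        (carrier (Z1 \<Gamma> (pullback_module \<phi> A')))))"
proof (intro conjI allI impI)
  fix \<phi> f
  assume c: "compatible_homs \<Gamma> A \<Gamma>' A' \<phi> f"
  interpret compatible_gr_cats \<Gamma> A \<Gamma>' A' \<xi> \<xi>' \<phi> f
    using assms c by (intro compatible_gr_cats.intro compatible_gr_cats_axioms.intro)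
  {
    assume "class3 \<Gamma> M obstruction = \<one>\<^bsub>H3 \<Gamma> M\<^esub>"
    then show "\<exists>b. bij_betw b (congruence_classes \<Gamma> A \<xi> \<Gamma>' A' \<xi>' \<phi> f) (carrier (H2 \<Gamma> M))"
      by (rule congruence_classes_bij_H2)
  next
    fix F assume "gr_functor C D F" "of_type \<Gamma> A \<phi> f F"
    then have "F \<in> functors" by (simp add: gr_functors_of_type_def)
    then show "\<exists>b. bij_betw b (Aut C D F) (carrier (Z1 \<Gamma> M))"
      using Aut_bij_Z1 by blast
  }
qed

end
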